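(* Let $n\ge5$ be prime, $\mathbb{F}_q$ a finite field with $q\equiv1\pmod n$, $\psi\in\mathbb{F}_q^*$, and $\chi$ a character of $\mathbb{F}_q^*$ of order $n$. Let $s=(s_1,\dots,s_n)\in(\mathbb{Z}/n\mathbb{Z})^n$ with $\sum s_i=0$, such that $s$ is not constant and its coordinates are not pairwise distinct (i.e. its class modulo the simultaneous actions of $\mathbb{Z}/n\mathbb{Z}$, $\mathfrak{S}_n$ and $(\mathbb{Z}/n\mathbb{Z})^\times$ is neither that of $(0,\dots,0)$ nor that of $(0,1,\dots,n-1)$). Let $k(b)=\#\{i:s_i=b\}$, $m=\#\{b:k(b)=0\}$, let $(v_1,\dots,v_m)$ be an enumeration of the $b$ with $k(b)=0$ and $(w_1,\dots,w_m)$ an enumeration of the $b$ with $k(b)\ge2$, each repeated $k(b)-1$ times, and assume there is an even integer $0\le m'\le m-2$ such that $w_{2i-1}-v_{2i-1}\equiv-(w_{2i}-v_{2i})\pmod n$ for all $1\le i\le m'/2$. Let $H\subset\mathbb{A}^{2m-m'-1}$ be the affine variety of dimension $2m-m'-3$ defined by \[\begin{cases} y^n=x_1^{v_1}\cdots x_m^{v_m}\,x_{m+1}^{v_{m'+1}-w_{m'+1}}\cdots x_{2m-m'-2}^{v_{m-2}-w_{m-2}}\,(1-x_1)^{w_1-v_1}\cdots(1-x_{m-1})^{w_{m-1}-v_{m-1}}\\ \qquad\qquad\cdot(1-x_m-\dots-x_{2m-m'-2})^{v_{m-1}-w_{m-1}},\\ x_1\cdots x_m=\psi^n,\end{cases}\]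 where every exponent is replaced by its representative in $\{1,\dots,n\}$. Put $N_{1/\psi^n}=\#H(\mathbb{F}_q)-(q-1)^{m-1}q^{m-m'-2}$. Then $\gamma(s)/K(s)$ is a positive integer and \[N_{\{s\}}=\frac{\gamma(s)}{K(s)}\,q^{\frac{n+1}{2}-\frac{2m-m'}{2}}\,N_{1/\psi^n}.\]
   Context: $\Omega$ is an algebraically closed field of characteristic zero; characters of $\mathbb{F}_q^*$ are homomorphisms $\mathbb{F}_q^*\to\Omega^*$, $\mathbf 1$ the trivial one. Fix a nontrivial additive character $\varphi$ of $\mathbb{F}_q$ and let $g(\chi)=\sum_{x\in\mathbb{F}_q^*}\varphi(x)\chi(x)$. For a tuple $t$ with $\sum t_i=0$ and a character $\eta$, with $z$ the number of $i$ with $\chi^{t_i}\eta=\mathbf 1$, $\delta=0$ if $z\ne0$ and $1$ otherwise, $\beta_{t,\chi,\eta}=q^{\frac{n+1}{2}-z-\delta}\frac{g(\eta)g(\chi\eta)\cdots g(\chi^{n-1}\eta)}{g(\chi^{t_1}\eta)\cdots g(\chi^{t_n}\eta)}$, and $N_{[t],\chi}=\frac1{q-1}\sum_\eta\beta_{t,\chi,\eta}\eta(1/\psi^n)$ ($\eta$ over all characters of $\mathbb{F}_q^*$). Actions: $j\in\mathbb{Z}/n\mathbb{Z}$ adds $j$ to all coordinates, $k\in(\mathbb{Z}/n\mathbb{Z})^\times$ multiplies all coordinates, $\mathfrak{S}_n$ permutes coordinates. $[t]$ is the orbit under $\mathbb{Z}/n\mathbb{Z}$; $\{s\}$ the orbit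 under all three actions. $N_{\{s\}}=\gamma(s)\sum N_{[s'],\chi}$, the sum over the distinct classes of $s'$ modulo $\mathbb{Z}/n\mathbb{Z}$ and $\mathfrak{S}_n$ contained in $\{s\}$. $\gamma(s)$ is the number of distinct permutations of $(s_1,\dots,s_n)$; $K(s)=\#\{k\in(\mathbb{Z}/n\mathbb{Z})^\times:[ks]=[{}^\sigma s]\text{ for some }\sigma\in\mathfrak{S}_n\}$. *)

theory Defs
  imports
    "HOL-Computational_Algebra.Computational_Algebra"
    "HOL-Combinatorics.Permutations"
    "HOL-Number_Theory.Cong"
    "HOL-Library.FuncSet"
    "HOL-Library.Cardinality"
begin

text \<open>
  A homomorphism from the multiplicative group of the field \<^typ>\<open>'a\<close> to that of \<^typ>\<open>'w\<close> is
  represented by its extension to \<^typ>\<open>'a\<close> by the value 0 at 0, for every character, the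
  trivial one included. Distinct characters thus correspond to distinct functions.
\<close>

definition mult_chars :: "('a::field \<Rightarrow> 'w::field) set" where
  "mult_chars = {\<chi>. \<chi> 0 = 0 \<and> \<chi> 1 = 1 \<and> (\<forall>x y. \<chi> (x * y) = \<chi> x * \<chi> y)}"

definition triv_char :: "'a::field \<Rightarrow> 'w::field" where
  "triv_char = (\<lambda>x. if x = 0 then 0 else 1)"

definition char_mult :: "('a::field \<Rightarrow> 'w::field) \<Rightarrow> ('a \<Rightarrow> 'w) \<Rightarrow> 'a \<Rightarrow> 'w" where
  "char_mult \<chi> \<eta> = (\<lambda>x. \<chi> x * \<eta> x)"

definition char_pow :: "('a::field \<Rightarrow> 'w::field) \<Rightarrow> nat \<Rightarrow> 'a \<Rightarrow> 'w" where
  "char_pow \<chi> k = (\<lambda>x. if x = 0 then 0 else \<chi> x ^ k)"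

definition char_has_order :: "('a::field \<Rightarrow> 'w::field) \<Rightarrow> nat \<Rightarrow> bool" where
  "char_has_order \<chi> n \<longleftrightarrow> n > 0 \<and> char_pow \<chi> n = triv_char \<and>
     (\<forall>k. 0 < k \<and> k < n \<longrightarrow> char_pow \<chi> k \<noteq> triv_char)"

definition nontrivial_add_char :: "('a::field \<Rightarrow> 'w::field) \<Rightarrow> bool" where
  "nontrivial_add_char \<phi> \<longleftrightarrow>
     \<phi> 0 = 1 \<and> (\<forall>x y. \<phi> (x + y) = \<phi> x * \<phi> y) \<and> (\<exists>x. \<phi> x \<noteq> 1)"

definition gauss_sum :: "('a::{field,finite} \<Rightarrow> 'w::field) \<Rightarrow> ('a \<Rightarrow> 'w) \<Rightarrow> 'w" where
  "gauss_sum \<phi> \<chi> = (\<Sum>x\<in>UNIV - {0}. \<phi> x * \<chi> x)"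

text \<open>
  Elements of \<open>\<int>/n\<int>\<close> are represented by natural numbers below \<open>n\<close>, and \<open>n\<close>-tuples by lists of
  length \<open>n\<close>; the coordinate \<open>t\<^sub>i\<close> of the mathematical notation is \<open>t ! (i - 1)\<close>.
\<close>

definition tuples :: "nat \<Rightarrow> nat list set" where
  "tuples n = {t. length t = n \<and> set t \<subseteq> {..<n}}"

definition translate :: "nat \<Rightarrow> nat \<Rightarrow> nat list \<Rightarrow> nat list" where
  "translate n j t = map (\<lambda>x. (x + j) mod n) t"

definition scale :: "nat \<Rightarrow> nat \<Rightarrow> nat list \<Rightarrow> nat list" where
  "scale n k t = map (\<lambda>x. (k * x) mod n) t"

definition units_mod :: "nat \<Rightarrow> nat set" where
  "units_mod n = {k. k < n \<and> coprime k n}"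

definition trans_orbit :: "nat \<Rightarrow> nat list \<Rightarrow> nat list set" where
  "trans_orbit n t = {translate n j t | j. j < n}"

definition trans_perm_orbit :: "nat \<Rightarrow> nat list \<Rightarrow> nat list set" where
  "trans_perm_orbit n t =
     {permute_list \<sigma> (translate n j t) | \<sigma> j. \<sigma> permutes {..<n} \<and> j < n}"

definition full_orbit :: "nat \<Rightarrow> nat list \<Rightarrow> nat list set" where
  "full_orbit n t =
     {permute_list \<sigma> (translate n j (scale n k t)) | \<sigma> j k.
        \<sigma> permutes {..<n} \<and> j < n \<and> k \<in> units_mod n}"

definition gamma_num :: "nat list \<Rightarrow> nat" where
  "gamma_num s = card {permute_list \<sigma> s | \<sigma>. \<sigma> permutes {..<length s}}"

definition K_num :: "nat \<Rightarrow> nat list \<Rightarrow> nat" where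
  "K_num n s = card {k \<in> units_mod n.
     \<exists>\<sigma>. \<sigma> permutes {..<n} \<and> trans_orbit n (scale n k s) = trans_orbit n (permute_list \<sigma> s)}"

definition triv_count :: "('a::field \<Rightarrow> 'w::field) \<Rightarrow> nat list \<Rightarrow> ('a \<Rightarrow> 'w) \<Rightarrow> nat" where
  "triv_count \<chi> t \<eta> =
     card {i. i < length t \<and> char_mult (char_pow \<chi> (t ! i)) \<eta> = triv_char}"

text \<open>
  The integer division in the exponent is exact because the definition is used for odd \<open>n\<close> only.
\<close>

definition beta ::
  "nat \<Rightarrow> ('a::{field,finite} \<Rightarrow> 'w::field) \<Rightarrow> ('a \<Rightarrow> 'w) \<Rightarrow> nat list \<Rightarrow> ('a \<Rightarrow> 'w) \<Rightarrow> 'w" where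
  "beta n \<phi> \<chi> t \<eta> =
     (let z = triv_count \<chi> t \<eta>; \<delta> = (if z \<noteq> 0 then 0 else 1)
      in of_nat CARD('a) powi (int ((n + 1) div 2) - int z - \<delta>)
         * ((\<Prod>j<n. gauss_sum \<phi> (char_mult (char_pow \<chi> j) \<eta>))
            / (\<Prod>i<n. gauss_sum \<phi> (char_mult (char_pow \<chi> (t ! i)) \<eta>))))"

definition N_tuple ::
  "nat \<Rightarrow> ('a::{field,finite} \<Rightarrow> 'w::field) \<Rightarrow> ('a \<Rightarrow> 'w) \<Rightarrow> 'a \<Rightarrow> nat list \<Rightarrow> 'w" where
  "N_tuple n \<phi> \<chi> \<psi> t =
     1 / (of_nat CARD('a) - 1) * (\<Sum>\<eta>\<in>mult_chars. beta n \<phi> \<chi> t \<eta> * \<eta> (1 / \<psi> ^ n))"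

text \<open>
  The value of \<^const>\<open>N_tuple\<close> is constant on each class \<open>C\<close> modulo translations and
  permutations (lemma \<open>N_tuple_trans_perm_orbit\<close> below), so any representative may be chosen.
\<close>

definition N_class ::
  "nat \<Rightarrow> ('a::{field,finite} \<Rightarrow> 'w::field) \<Rightarrow> ('a \<Rightarrow> 'w) \<Rightarrow> 'a \<Rightarrow> nat list set \<Rightarrow> 'w" where
  "N_class n \<phi> \<chi> \<psi> C = N_tuple n \<phi> \<chi> \<psi> (SOME t. t \<in> C)"

definition N_full ::
  "nat \<Rightarrow> ('a::{field,finite} \<Rightarrow> 'w::field) \<Rightarrow> ('a \<Rightarrow> 'w) \<Rightarrow> 'a \<Rightarrow> nat list \<Rightarrow> 'w" where
  "N_full n \<phi> \<chi> \<psi> s =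
     of_nat (gamma_num s) * (\<Sum>C\<in>trans_perm_orbit n ` full_orbit n s. N_class n \<phi> \<chi> \<psi> C)"

text \<open>The representative in \<open>{1,\<dots>,n}\<close> of an integer modulo \<open>n\<close>.\<close>

definition rep1 :: "nat \<Rightarrow> int \<Rightarrow> nat" where
  "rep1 n a = nat ((a - 1) mod int n + 1)"

text \<open>
  \<open>m1\<close> stands for \<open>m'\<close>. A point is a pair of the coordinates \<open>(x\<^sub>1,\<dots>,x\<^sub>d)\<close>, where
  \<open>d = 2m - m' - 2\<close>, and the coordinate \<open>y\<close>; the \<open>v i\<close> and \<open>w i\<close> are indexed from 1.
\<close>

definition H_points ::
  "nat \<Rightarrow> nat \<Rightarrow> nat \<Rightarrow> (nat \<Rightarrow> nat) \<Rightarrow> (nat \<Rightarrow> nat) \<Rightarrow> 'a::field \<Rightarrow> ((nat \<Rightarrow> 'a) \<times> 'a) set" where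
  "H_points n m m1 v w \<psi> =
     {(x, y). x \<in> {1..2 * m - m1 - 2} \<rightarrow>\<^sub>E UNIV \<and>
        y ^ n =
          (\<Prod>i = 1..m. x i ^ rep1 n (int (v i)))
          * (\<Prod>i = m1 + 1..m - 2. x (m + (i - m1)) ^ rep1 n (int (v i) - int (w i)))
          * (\<Prod>i = 1..m - 1. (1 - x i) ^ rep1 n (int (w i) - int (v i)))
          * (1 - (\<Sum>i = m..2 * m - m1 - 2. x i)) ^ rep1 n (int (v (m - 1)) - int (w (m - 1))) \<and>
        (\<Prod>i = 1..m. x i) = \<psi> ^ n}"

lemma char_mult_char_pow_add:
  assumes "char_has_order \<chi> n"
  shows "char_mult (char_pow \<chi> ((a + j) mod n)) \<eta> =
         char_mult (char_pow \<chi> a) (char_mult (char_pow \<chi> j) \<eta>)"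
proof
  fix x
  show "char_mult (char_pow \<chi> ((a + j) mod n)) \<eta> x =
         char_mult (char_pow \<chi> a) (char_mult (char_pow \<chi> j) \<eta>) x"
  proof (cases "x = 0")
    case False
    have "char_pow \<chi> n x = triv_char x"
      using assms by (simp add: char_has_order_def)
    hence 1: "\<chi> x ^ n = 1" using False by (simp add: char_pow_def triv_char_def)
    have "\<chi> x ^ (a + j) = \<chi> x ^ (n * ((a + j) div n) + (a + j) mod n)"
      by simp
    also have "\<dots> = \<chi> x ^ ((a + j) mod n)"
      by (simp only: power_add power_mult 1) simp
    finally show ?thesis using False
      by (simp add: char_mult_def char_pow_def power_add)
  qed (simp add: char_mult_def char_pow_def)
qed

lemma char_mult_char_pow_in:
  assumes "\<chi> \<in> mult_chars" "\<eta> \<in> mult_chars"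
  shows "char_mult (char_pow \<chi> j) \<eta> \<in> mult_chars"
  using assms by (auto simp: mult_chars_def char_mult_def char_pow_def power_mult_distrib)

lemma bij_betw_add_mod:
  fixes n j :: nat
  assumes "n > 0"
  shows "bij_betw (\<lambda>i. (i + j) mod n) {..<n} {..<n}"
proof -
  have "inj_on (\<lambda>i. (i + j) mod n) {..<n}"
  proof (rule inj_onI)
    fix a b assume "a \<in> {..<n}" "b \<in> {..<n}" "(a + j) mod n = (b + j) mod n"
    thus "a = b" by (auto simp: cong_def[symmetric] cong_add_rcancel_nat cong_less_modulus_unique_nat)
  qed
  moreover have "(\<lambda>i. (i + j) mod n) ` {..<n} \<subseteq> {..<n}" using assms by auto
  ultimately show ?thesis
    by (simp add: bij_betw_def endo_inj_surj)
qed

lemma beta_translate: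
  assumes "char_has_order \<chi> n" "length t = n"
  shows "beta n \<phi> \<chi> (translate n j t) \<eta> = beta n \<phi> \<chi> t (char_mult (char_pow \<chi> j) \<eta>)"
proof -
  have n: "n > 0" using assms(1) by (simp add: char_has_order_def)
  have *: "char_mult (char_pow \<chi> (translate n j t ! i)) \<eta> =
           char_mult (char_pow \<chi> (t ! i)) (char_mult (char_pow \<chi> j) \<eta>)" if "i < n" for i
    using that assms(2) by (simp add: translate_def char_mult_char_pow_add[OF assms(1)])
  have z: "triv_count \<chi> (translate n j t) \<eta> = triv_count \<chi> t (char_mult (char_pow \<chi> j) \<eta>)"
    unfolding triv_count_def using assms(2) *
    by (intro arg_cong[where f = card]) (auto simp: translate_def)
  have "(\<Prod>i<n. gauss_sum \<phi> (char_mult (char_pow \<chi> ((i + j) mod n)) \<eta>)) =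
        (\<Prod>i<n. gauss_sum \<phi> (char_mult (char_pow \<chi> i) \<eta>))"
    by (rule prod.reindex_bij_betw[OF bij_betw_add_mod[OF n]])
  hence num: "(\<Prod>i<n. gauss_sum \<phi> (char_mult (char_pow \<chi> i) \<eta>)) =
        (\<Prod>i<n. gauss_sum \<phi> (char_mult (char_pow \<chi> i) (char_mult (char_pow \<chi> j) \<eta>)))"
    by (simp add: char_mult_char_pow_add[OF assms(1)])
  show ?thesis
    unfolding beta_def z num using * by simp
qed

lemma N_tuple_translate:
  assumes "\<chi> \<in> mult_chars" "char_has_order \<chi> n" "length t = n" "\<psi> \<noteq> 0" "j < n"
  shows "N_tuple n \<phi> \<chi> \<psi> (translate n j t) = N_tuple n \<phi> \<chi> \<psi> t"
proof -
  have pw: "\<chi> (x ^ k) = \<chi> x ^ k" for x k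
    using assms(1) by (induction k) (auto simp: mult_chars_def)
  have ord: "\<chi> x ^ n = 1" if "x \<noteq> 0" for x
  proof -
    have "char_pow \<chi> n x = triv_char x" using assms(2) by (simp add: char_has_order_def)
    thus ?thesis using that by (simp add: char_pow_def triv_char_def)
  qed
  have ev: "char_mult (char_pow \<chi> j) \<eta> (1 / \<psi> ^ n) = \<eta> (1 / \<psi> ^ n)" for \<eta>
  proof -
    have "\<chi> (1 / \<psi> ^ n) = 1"
      using pw[of "1 / \<psi>" n] ord[of "1 / \<psi>"] assms(4) by (simp add: power_one_over)
    thus ?thesis using assms(4) by (simp add: char_mult_def char_pow_def)
  qed
  have inv: "char_mult (char_pow \<chi> a) (char_mult (char_pow \<chi> b) \<eta>) = \<eta>"
    if "a + b = n" "\<eta> \<in> mult_chars" for a b \<eta>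
    using that(2)
    by (subst char_mult_char_pow_add[OF assms(2), symmetric])
       (auto simp: that(1) char_mult_def char_pow_def mult_chars_def fun_eq_iff)
  have "(\<Sum>\<eta>\<in>mult_chars. beta n \<phi> \<chi> t (char_mult (char_pow \<chi> j) \<eta>) * \<eta> (1 / \<psi> ^ n)) =
        (\<Sum>\<eta>\<in>mult_chars. beta n \<phi> \<chi> t \<eta> * \<eta> (1 / \<psi> ^ n))"
    by (rule sum.reindex_bij_witness[where j = "char_mult (char_pow \<chi> j)"
            and i = "char_mult (char_pow \<chi> (n - j))"])
       (use assms in \<open>auto simp: inv char_mult_char_pow_in ev\<close>)
  thus ?thesis
    by (simp add: N_tuple_def beta_translate[OF assms(2,3)])
qed

lemma N_tuple_permute:
  assumes "\<sigma> permutes {..<n}" "length t = n"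
  shows "N_tuple n \<phi> \<chi> \<psi> (permute_list \<sigma> t) = N_tuple n \<phi> \<chi> \<psi> t"
proof -
  have nth: "permute_list \<sigma> t ! i = t ! \<sigma> i" if "i < n" for i
    using that assms by (simp add: permute_list_nth)
  have z: "triv_count \<chi> (permute_list \<sigma> t) \<eta> = triv_count \<chi> t \<eta>" for \<eta>
  proof -
    have "bij_betw \<sigma> {i. i < n \<and> char_mult (char_pow \<chi> (t ! \<sigma> i)) \<eta> = triv_char}
            {i. i < n \<and> char_mult (char_pow \<chi> (t ! i)) \<eta> = triv_char}"
      (is "bij_betw _ ?A ?B")
    proof (rule bij_betw_imageI)
      show "inj_on \<sigma> ?A" using permutes_inj_on[OF assms(1)] by blast
      show "\<sigma> ` ?A = ?B"
      proof (intro equalityI subsetI)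
        fix i assume "i \<in> ?B"
        moreover obtain k where "k \<in> {..<n}" "i = \<sigma> k"
          using calculation permutes_image[OF assms(1)] by (metis (lifting) imageE lessThan_iff mem_Collect_eq)
        ultimately show "i \<in> \<sigma> ` ?A" by auto
      qed (use permutes_in_image[OF assms(1)] in auto)
    qed
    hence "card ?A = card ?B" by (rule bij_betw_same_card)
    thus ?thesis unfolding triv_count_def using assms(2) nth
      by (simp cong: conj_cong)
  qed
  have "(\<Prod>i<n. gauss_sum \<phi> (char_mult (char_pow \<chi> (permute_list \<sigma> t ! i)) \<eta>)) =
        (\<Prod>i<n. gauss_sum \<phi> (char_mult (char_pow \<chi> (t ! i)) \<eta>))" for \<eta>
    using prod.reindex_bij_betw[OF permutes_imp_bij[OF assms(1)],
        of "\<lambda>i. gauss_sum \<phi> (char_mult (char_pow \<chi> (t ! i)) \<eta>)"]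
    by (simp add: nth)
  thus ?thesis by (simp add: N_tuple_def beta_def z)
qed

lemma N_tuple_trans_perm_orbit:
  assumes "\<chi> \<in> mult_chars" "char_has_order \<chi> n" "length t = n" "\<psi> \<noteq> 0"
    and "t' \<in> trans_perm_orbit n t"
  shows "N_tuple n \<phi> \<chi> \<psi> t' = N_tuple n \<phi> \<chi> \<psi> t"
proof -
  obtain \<sigma> j where t': "t' = permute_list \<sigma> (translate n j t)" "\<sigma> permutes {..<n}" "j < n"
    using assms(5) by (auto simp: trans_perm_orbit_def)
  have "length (translate n j t) = n" using assms(3) by (simp add: translate_def)
  thus ?thesis using t' assms(1-4) by (simp add: N_tuple_permute N_tuple_translate)
qed

end

theory Submission
  imports Defs "HOL-Algebra.Algebraic_Closure_Type"
begin

text \<open>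
  Cancelling equal Gauss sums, the quotient in \<open>\<beta>\<close> becomes the product of the
  \<open>g(\<chi>\<^bsup>v\<^esup>\<eta>) / g(\<chi>\<^bsup>w\<^esup>\<eta>)\<close> over \<open>(v, w) = (v\<^sub>i, w\<^sub>i)\<close>,
  and the power of \<open>q\<close> in \<open>\<beta>\<close> is exactly what turns each factor into the Jacobi sum \<open>J(\<chi>\<^bsup>v\<^esup>\<eta>, \<chi>\<^bsup>w-v\<^esup>)\<close> divided by \<open>g(\<chi>\<^bsup>w-v\<^esup>)\<close>, also when \<open>\<chi>\<^bsup>w\<^esup>\<eta>\<close> is trivial.
  Summing over \<open>\<eta>\<close> restricts the product of the Jacobi sums to the torus \<open>x\<^sub>1\<cdots>x\<^sub>m = \<psi>\<^sup>n\<close>.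
  The Gauss sums \<open>g(\<chi>\<^bsup>w-v\<^esup>)\<close> belonging to the \<open>m'\<close> paired indices multiply to a power of \<open>q\<close>, and
  the remaining ones, whose characters have trivial product, are traded for one multivariable Jacobi
  sum, which is merged with the factor \<open>\<chi>(1 - x\<^sub>m)\<close> by homogeneity. Hence
  \<open>N\<^bsub>[s],\<chi>\<^esub>\<close> is a power of \<open>q\<close> times the sum of \<open>\<chi>\<close> over the values of the right-hand side of the
  equation for \<open>y\<^sup>n\<close>. Replacing \<open>\<chi>\<close> by \<open>\<chi>\<^sup>j\<close> amounts to replacing \<open>s\<close> by \<open>js\<close>, summing over
  \<open>0 < j < n\<close> counts the points of \<open>H\<close>, and each class in \<open>{s}\<close> arises from \<open>K(s)\<close> values of \<open>j\<close>.
\<close>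

hide_const (open) Divisibility.prime Coset.order

section \<open>Units of a finite field and roots of unity\<close>

lemma finite_field_generator:
  obtains g :: "'a::{field,finite}" where "g \<noteq> 0" "\<And>x. x \<noteq> 0 \<Longrightarrow> \<exists>i::nat. x = g ^ i"
proof -
  \<comment> \<open>\<open>HOL-Algebra\<close> proves cyclicity for fields given as records;
    \<open>ring_of_type_algebra\<close> turns the type into such a record.\<close>
  let ?R = "ring_of_type_algebra :: 'a ring"
  interpret R: field ?R by (rule field_from_type_algebra)
  have pow: "a [^]\<^bsub>?R\<^esub> i = a ^ i" for a :: 'a and i :: nat
    by (induction i) (simp_all add: ring_of_type_algebra_def mult.commute)
  obtain g where g: "g \<in> carrier (Multiplicative_Group.mult_of ?R)"
      "carrier (Multiplicative_Group.mult_of ?R) = {g [^]\<^bsub>?R\<^esub> i |i::nat. i \<in> UNIV}"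
    using R.finite_field_mult_group_has_gen by auto
  have carr: "carrier (Multiplicative_Group.mult_of ?R) = UNIV - {0}"
    by (simp add: Multiplicative_Group.mult_of_def ring_of_type_algebra_def)
  show ?thesis
    by (rule that[of g]) (use g carr pow in auto)
qed

text \<open>Multiplication by \<open>x\<close> permutes the nonzero elements, so their product
  absorbs the factor \<open>x ^ (CARD('a) - 1)\<close>.\<close>

lemma finite_field_power_card_minus_1:
  fixes x :: "'a::{field,finite}"
  assumes "x \<noteq> 0"
  shows "x ^ (CARD('a) - 1) = 1"
proof -
  let ?U = "UNIV - {0::'a}"
  have "(\<Prod>y\<in>?U. x * y) = (\<Prod>y\<in>?U. y)"
    by (rule prod.reindex_bij_witness[where i = "\<lambda>y. y / x" and j = "\<lambda>y. x * y"]) (use assms in auto)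
  hence "x ^ card ?U * (\<Prod>y\<in>?U. y) = (\<Prod>y\<in>?U. y)"
    by (simp add: prod.distrib)
  moreover have "(\<Prod>y\<in>?U. y) \<noteq> 0" by simp
  ultimately show ?thesis by (simp add: card_Diff_singleton)
qed

lemma finite_field_card_gt_1: "CARD('a::{field,finite}) > 1"
proof -
  have "card {0, 1::'a} \<le> CARD('a)" by (intro card_mono) auto
  thus ?thesis by simp
qed

text \<open>Exponents may be reduced modulo \<open>CARD('a) - 1\<close>, so the smaller ones already
  reach every unit; comparing cardinalities then gives injectivity.\<close>

lemma finite_field_generator_bij:
  obtains g :: "'a::{field,finite}"
  where "g \<noteq> 0" "bij_betw (\<lambda>i. g ^ i) {..<CARD('a) - 1} (UNIV - {0})"
proof -
  obtain g :: 'a where g: "g \<noteq> 0" "\<And>x. x \<noteq> 0 \<Longrightarrow> \<exists>i::nat. x = g ^ i"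
    by (rule finite_field_generator) auto
  let ?N = "CARD('a) - 1"
  have N: "?N > 0" using finite_field_card_gt_1[where 'a = 'a] by simp
  have red: "g ^ i = g ^ (i mod ?N)" for i
  proof -
    have "g ^ i = g ^ (?N * (i div ?N) + i mod ?N)" by simp
    also have "\<dots> = g ^ (i mod ?N)"
      unfolding power_add power_mult finite_field_power_card_minus_1[OF g(1)] by simp
    finally show ?thesis .
  qed
  have img: "(\<lambda>i. g ^ i) ` {..<?N} = UNIV - {0}"
  proof (intro equalityI subsetI)
    fix x :: 'a assume "x \<in> UNIV - {0}"
    then obtain i where "x = g ^ i" using g(2) by auto
    hence "x = g ^ (i mod ?N)" using red by simp
    thus "x \<in> (\<lambda>i. g ^ i) ` {..<?N}" using N by auto
  qed (use g(1) in auto)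
  have "inj_on (\<lambda>i. g ^ i) {..<?N}"
    by (rule eq_card_imp_inj_on) (simp_all only: img card_Diff_singleton finite_lessThan card_lessThan UNIV_I)
  thus ?thesis using img g(1) that[of g] by (simp add: bij_betw_def)
qed

text \<open>\<open>X^N - 1\<close> splits over an algebraically closed field, and in characteristic
  zero it has no root in common with its derivative \<open>N X^(N-1)\<close>, so its roots are
  simple.\<close>

lemma card_roots_of_unity:
  assumes "N > 0"
  shows "card {z::'w::{alg_closed_field,field_char_0}. z ^ N = 1} = N"
proof -
  define p :: "'w poly" where "p = Polynomial.monom 1 N - 1"
  have deg: "Polynomial.degree p = N"
    unfolding p_def diff_conv_add_uminus
    using assms by (subst degree_add_eq_left) (auto simp: Polynomial.degree_monom_eq)
  hence p0: "p \<noteq> 0" using assms by auto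
  have "rsquarefree p"
    unfolding rsquarefree_roots
    using assms by (auto simp: p_def Polynomial.poly_monom pderiv_diff pderiv_monom power_0_left)
  hence ord: "Polynomial.order x p \<le> 1" for x
    by (metis rsquarefree_def le_refl zero_le_one)
  obtain A where A: "size A = Polynomial.degree p"
      "p = Polynomial.smult (Polynomial.lead_coeff p) (\<Prod>x\<in>#A. [:-x, 1:])"
    using alg_closed_imp_factorization[OF p0] by auto
  \<comment> \<open>This identifies the multiset \<open>A\<close> of the factorization with the
    roots of \<open>p\<close> counted with multiplicity.\<close>
  have "proots (\<Prod>x\<in>#A. [:-x, 1:]) = A"
  proof (induction A)
    case (add x A)
    have "(\<Prod>x\<in>#A. [:-x, 1:]) \<noteq> 0" by (auto simp: prod_mset_zero_iff)
    hence "proots ([:-x, 1:] * (\<Prod>x\<in>#A. [:-x, 1:])) = proots [:-x, 1:] + A"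
      by (subst proots_mult) (simp_all add: add.IH del: mult_pCons_left)
    thus ?case by (simp del: mult_pCons_left)
  qed simp
  hence pr: "proots p = A" using p0 by (subst A(2)) auto
  have "count A x = (if x \<in># A then 1 else 0)" for x
    using ord[of x] p0 unfolding pr[symmetric] by (auto simp: order_root)
  hence "A = mset_set (set_mset A)"
    by (intro multiset_eqI) (simp add: count_mset_set')
  hence "card (set_mset A) = N" using A(1) deg by (metis size_mset_set)
  moreover have "set_mset A = {z. z ^ N = 1}"
    using p0 by (auto simp: pr[symmetric] p_def Polynomial.poly_monom)
  ultimately show ?thesis by simp
qed

section \<open>Multiplicative characters\<close>

lemma mult_chars_0: "\<eta> \<in> mult_chars \<Longrightarrow> \<eta> 0 = 0"
  and mult_chars_1: "\<eta> \<in> mult_chars \<Longrightarrow> \<eta> 1 = 1"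
  and mult_chars_mult: "\<eta> \<in> mult_chars \<Longrightarrow> \<eta> (x * y) = \<eta> x * \<eta> y"
  by (auto simp: mult_chars_def)

lemma mult_chars_power: "\<eta> \<in> mult_chars \<Longrightarrow> \<eta> (x ^ k) = \<eta> x ^ k"
  by (induction k) (auto simp: mult_chars_def)

lemma mult_chars_prod: "\<eta> \<in> mult_chars \<Longrightarrow> \<eta> (\<Prod>i\<in>I. f i) = (\<Prod>i\<in>I. \<eta> (f i))"
  by (induction I rule: infinite_finite_induct) (auto simp: mult_chars_1 mult_chars_mult)

lemma mult_chars_eq_0_iff: "\<eta> \<in> mult_chars \<Longrightarrow> \<eta> x = 0 \<longleftrightarrow> x = 0"
  by (metis mult_chars_0 mult_chars_1 mult_chars_mult mult_zero_left right_inverse zero_neq_one)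

lemma triv_char_in: "triv_char \<in> mult_chars"
  by (auto simp: mult_chars_def triv_char_def)

lemma char_pow_in: "\<chi> \<in> mult_chars \<Longrightarrow> char_pow \<chi> k \<in> mult_chars"
  by (auto simp: mult_chars_def char_pow_def power_mult_distrib)

lemma char_mult_in: "\<chi> \<in> mult_chars \<Longrightarrow> \<eta> \<in> mult_chars \<Longrightarrow> char_mult \<chi> \<eta> \<in> mult_chars"
  by (auto simp: mult_chars_def char_mult_def)

lemma mult_chars_nontrivialE:
  assumes "\<eta> \<in> mult_chars" "\<eta> \<noteq> triv_char"
  obtains c where "c \<noteq> 0" "\<eta> c \<noteq> 1"
  using assms by (auto simp: fun_eq_iff triv_char_def mult_chars_0 split: if_splits)

text \<open>A character is determined by its value at a generator \<open>g\<close>, and every root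
  of unity of order dividing \<open>CARD('a) - 1\<close> occurs as such a value. The three facts
  share the discrete logarithm to base \<open>g\<close>.\<close>

lemma card_mult_chars:
  "card (mult_chars :: ('a::{field,finite} \<Rightarrow> 'w::{alg_closed_field,field_char_0}) set) = CARD('a) - 1"
  and finite_mult_chars:
  "finite (mult_chars :: ('a::{field,finite} \<Rightarrow> 'w::{alg_closed_field,field_char_0}) set)"
  and mult_chars_separate:
  "(a::'a) \<noteq> 0 \<Longrightarrow> a \<noteq> 1 \<Longrightarrow> \<exists>\<eta>\<in>mult_chars. \<eta> a \<noteq> (1::'w)"
proof -
  obtain g :: 'a where g: "g \<noteq> 0" "bij_betw (\<lambda>i. g ^ i) {..<CARD('a) - 1} (UNIV - {0})"
    by (rule finite_field_generator_bij)
  define N where "N = CARD('a) - 1"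
  have N: "N > 0" using finite_field_card_gt_1[where 'a = 'a] by (simp add: N_def)
  let ?M = "mult_chars :: ('a \<Rightarrow> 'w) set"
  have gN: "g ^ N = 1" using finite_field_power_card_minus_1[OF g(1)] by (simp add: N_def)
  define dlog where "dlog x = the_inv_into {..<N} (\<lambda>i. g ^ i) x" for x
  have dlog: "dlog x < N" "g ^ dlog x = x" if "x \<noteq> 0" for x
    using bij_betw_def g(2) that the_inv_into_into[of "\<lambda>i. g ^ i" "{..<N}" x "{..<N}"]
      f_the_inv_into_f_bij_betw[of "\<lambda>i. g ^ i" "{..<N}" "UNIV - {0}" x]
    by (auto simp: N_def dlog_def bij_betw_def)
  have cong: "[i = j] (mod N)" if "g ^ i = g ^ j" for i j
  proof -
    have red: "g ^ i = g ^ (i mod N)" for i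
    proof -
      have "g ^ i = g ^ (N * (i div N) + i mod N)" by simp
      also have "\<dots> = g ^ (i mod N)" unfolding power_add power_mult gN by simp
      finally show ?thesis .
    qed
    have "g ^ (i mod N) = g ^ (j mod N)" using that red by metis
    hence "i mod N = j mod N"
      using g(2) N by (auto simp: bij_betw_def inj_on_def N_def)
    thus ?thesis by (simp add: cong_def)
  qed
  \<comment> \<open>The character is \<open>g ^ i \<mapsto> z ^ i\<close>, independent of the choice
    of the exponent because \<open>z ^ N = 1\<close>.\<close>
  have surj: "\<exists>\<eta>\<in>?M. \<eta> g = z" if z: "z ^ N = 1" for z
  proof -
    define \<eta> where "\<eta> x = (if x = 0 then 0 else z ^ dlog x)" for x :: 'a
    have zred: "z ^ i = z ^ j" if "[i = j] (mod N)" for i j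
    proof -
      have "z ^ i = z ^ (N * (i div N) + i mod N)" for i by simp
      hence "z ^ i = z ^ (i mod N)" for i unfolding power_add power_mult z by simp
      thus ?thesis using that by (metis cong_def)
    qed
    have ev: "\<eta> (g ^ i) = z ^ i" for i
      using dlog[of "g ^ i"] g(1) by (auto simp: \<eta>_def intro!: zred cong)
    have "\<eta> (x * y) = \<eta> x * \<eta> y" for x y
    proof (cases "x = 0 \<or> y = 0")
      case False
      hence "\<eta> (x * y) = \<eta> (g ^ (dlog x + dlog y))" by (simp add: power_add dlog)
      thus ?thesis unfolding ev using False by (simp add: power_add \<eta>_def)
    qed (auto simp: \<eta>_def)
    moreover have "\<eta> 1 = 1" using ev[of 0] by simp
    ultimately have "\<eta> \<in> ?M" by (auto simp: mult_chars_def \<eta>_def)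
    thus ?thesis using ev[of 1] by auto
  qed
  have bij: "bij_betw (\<lambda>\<eta>. \<eta> g) ?M {z. z ^ N = 1}"
  proof (rule bij_betw_imageI)
    show "inj_on (\<lambda>\<eta>. \<eta> g) ?M"
    proof (rule inj_onI)
      fix \<eta> \<theta> :: "'a \<Rightarrow> 'w" assume *: "\<eta> \<in> ?M" "\<theta> \<in> ?M" "\<eta> g = \<theta> g"
      show "\<eta> = \<theta>"
      proof
        fix x show "\<eta> x = \<theta> x"
        proof (cases "x = 0")
          case False
          have "\<eta> (g ^ dlog x) = \<theta> (g ^ dlog x)" using * by (simp add: mult_chars_power)
          thus ?thesis using dlog[OF False] by simp
        qed (use * in \<open>simp add: mult_chars_0\<close>)
      qed
    qed
    show "(\<lambda>\<eta>. \<eta> g) ` ?M = {z. z ^ N = 1}"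
      using surj gN by (auto simp: mult_chars_power[symmetric] mult_chars_1)
  qed
  have card: "card {z::'w. z ^ N = 1} = N" by (rule card_roots_of_unity[OF N])
  thus "card ?M = CARD('a) - 1" using bij_betw_same_card[OF bij] by (simp add: N_def)
  thus "finite ?M" using N by (auto simp: N_def intro: card_ge_0_finite)
  show "\<exists>\<eta>\<in>?M. \<eta> a \<noteq> 1" if a: "a \<noteq> 0" "a \<noteq> 1"
  proof (rule ccontr)
    \<comment> \<open>If all characters were 1 at \<open>a = g ^ k\<close> with
      \<open>0 < k < N\<close>, then all \<open>N\<close> of the \<open>N\<close>-th roots of unity
      would lie among the \<open>k\<close>-th ones, of which there are only
      \<open>k\<close>.\<close>
    assume none: "\<not> ?thesis"
    let ?k = "dlog a"
    have k: "0 < ?k" "?k < N" using dlog[OF a(1)] a(2) by (auto intro!: Nat.gr0I)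
    have "z ^ ?k = 1" if "z ^ N = 1" for z :: 'w
      using surj[OF that] none dlog(2)[OF a(1)] by (metis mult_chars_power)
    hence "card {z::'w. z ^ N = 1} \<le> card {z::'w. z ^ ?k = 1}"
      using card_roots_of_unity[OF k(1), where 'w = 'w] k
      by (intro card_mono) (auto intro!: card_ge_0_finite)
    thus False using card card_roots_of_unity[OF k(1), where 'w = 'w] k by simp
  qed
qed

text \<open>Orthogonality: twisting by some \<open>\<theta>\<close> with
  \<open>\<theta> a \<noteq> 1\<close> permutes the characters but multiplies the sum by
  \<open>\<theta> a\<close>.\<close>

lemma sum_mult_chars:
  fixes a :: "'a::{field,finite}"
  shows "(\<Sum>\<eta>\<in>mult_chars. \<eta> a) =
    (if a = 1 then of_nat CARD('a) - 1 else (0::'w::{alg_closed_field,field_char_0}))"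
proof -
  let ?M = "mult_chars :: ('a \<Rightarrow> 'w) set"
  consider "a = 0" | "a = 1" | "a \<noteq> 0" "a \<noteq> 1" by auto
  thus ?thesis
  proof cases
    case 1
    thus ?thesis by (simp add: mult_chars_0)
  next
    case 2
    thus ?thesis using finite_field_card_gt_1[where 'a = 'a]
      by (simp add: mult_chars_1 card_mult_chars of_nat_diff)
  next
    case 3
    then obtain \<theta> :: "'a \<Rightarrow> 'w" where \<theta>: "\<theta> \<in> ?M" "\<theta> a \<noteq> 1"
      using mult_chars_separate by blast
    have inj: "inj_on (char_mult \<theta>) ?M"
    proof (rule inj_onI)
      fix \<eta> \<eta>' assume *: "\<eta> \<in> ?M" "\<eta>' \<in> ?M" "char_mult \<theta> \<eta> = char_mult \<theta> \<eta>'"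
      show "\<eta> = \<eta>'"
      proof
        fix x
        have "\<theta> x * \<eta> x = \<theta> x * \<eta>' x" using *(3) by (metis char_mult_def)
        thus "\<eta> x = \<eta>' x" using * \<theta>(1) by (cases "x = 0") (auto simp: mult_chars_0 mult_chars_eq_0_iff)
      qed
    qed
    have "char_mult \<theta> ` ?M = ?M"
      by (rule endo_inj_surj[OF finite_mult_chars _ inj]) (use \<theta> char_mult_in in blast)
    hence "(\<Sum>\<eta>\<in>?M. \<eta> a) = (\<Sum>\<eta>\<in>?M. char_mult \<theta> \<eta> a)"
      using sum.reindex[OF inj, of "\<lambda>\<eta>. \<eta> a"] by simp
    also have "\<dots> = \<theta> a * (\<Sum>\<eta>\<in>?M. \<eta> a)" by (simp add: char_mult_def sum_distrib_left)
    finally show ?thesis using \<theta>(2) 3 by simp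
  qed
qed

lemma sum_nontrivial_mult_char:
  fixes \<eta> :: "'a::{field,finite} \<Rightarrow> 'w::field"
  assumes "\<eta> \<in> mult_chars" "\<eta> \<noteq> triv_char"
  shows "(\<Sum>x\<in>UNIV. \<eta> x) = 0"
proof -
  obtain c where c: "c \<noteq> 0" "\<eta> c \<noteq> 1" using mult_chars_nontrivialE[OF assms] .
  have "(\<Sum>x\<in>UNIV. \<eta> x) = (\<Sum>x\<in>UNIV. \<eta> (c * x))"
    by (rule sum.reindex_bij_witness[where j = "\<lambda>y. y / c" and i = "\<lambda>y. c * y"]) (use c in auto)
  also have "\<dots> = \<eta> c * (\<Sum>x\<in>UNIV. \<eta> x)" by (simp add: mult_chars_mult[OF assms(1)] sum_distrib_left)
  finally show ?thesis using c by simp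
qed

lemma sum_triv_char:
  "(\<Sum>x\<in>UNIV. triv_char (x::'a::{field,finite})) = (of_nat CARD('a) - 1 :: 'w::field)"
proof -
  have "(\<Sum>x\<in>UNIV. triv_char (x::'a)) = (\<Sum>x\<in>UNIV - {0::'a}. 1::'w)"
    by (rule sum.mono_neutral_cong_right) (auto simp: triv_char_def)
  thus ?thesis using finite_field_card_gt_1[where 'a = 'a]
    by (simp add: card_Diff_singleton of_nat_diff)
qed

lemma char_pow_eq_triv_iff:
  assumes "char_has_order \<chi> n"
  shows "char_pow \<chi> k = triv_char \<longleftrightarrow> n dvd k"
proof -
  have n: "n > 0" and t: "char_pow \<chi> n = triv_char"
    and l: "\<And>k. 0 < k \<Longrightarrow> k < n \<Longrightarrow> char_pow \<chi> k \<noteq> triv_char"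
    using assms by (auto simp: char_has_order_def)
  have 1: "\<chi> x ^ n = 1" if "x \<noteq> 0" for x
    using fun_cong[OF t, of x] that by (simp add: char_pow_def triv_char_def)
  have "char_pow \<chi> k = char_pow \<chi> (k mod n)"
  proof
    fix x
    have "\<chi> x ^ k = \<chi> x ^ (n * (k div n) + k mod n)" by simp
    thus "char_pow \<chi> k x = char_pow \<chi> (k mod n) x"
      unfolding power_add power_mult using 1[of x] by (auto simp: char_pow_def)
  qed
  moreover have "char_pow \<chi> (k mod n) = triv_char \<longleftrightarrow> k mod n = 0"
    using l[of "k mod n"] n by (cases "k mod n = 0") (auto simp: char_pow_def triv_char_def)
  ultimately show ?thesis by (simp add: dvd_eq_mod_eq_0)
qed

lemma char_pow_order_eq_1: "char_has_order \<chi> n \<Longrightarrow> x \<noteq> 0 \<Longrightarrow> \<chi> x ^ n = 1"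
  unfolding char_has_order_def by (metis char_pow_def triv_char_def)

lemma char_power_cong:
  assumes "char_has_order \<chi> n" "[i = j] (mod n)" "x \<noteq> 0"
  shows "\<chi> x ^ i = \<chi> x ^ j"
proof -
  have "\<chi> x ^ i = \<chi> x ^ (n * (i div n) + i mod n)" for i by simp
  hence "\<chi> x ^ i = \<chi> x ^ (i mod n)" for i
    unfolding power_add power_mult char_pow_order_eq_1[OF assms(1,3)] by simp
  thus ?thesis using assms(2) by (metis cong_def)
qed

text \<open>For nonzero \<open>a\<close> the right-hand side is a geometric sum in
  \<open>\<chi> a\<close>, and \<open>\<chi> a = 1\<close> exactly when \<open>a\<close> is an
  \<open>n\<close>-th power. The term 1 is kept apart because \<open>char_pow \<chi> 0\<close>
  vanishes at 0, where there is still the root \<open>y = 0\<close>.\<close>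

lemma card_nth_roots:
  fixes \<chi> :: "'a::{field,finite} \<Rightarrow> 'w::field_char_0" and a :: 'a
  assumes "\<chi> \<in> mult_chars" "char_has_order \<chi> n"
  shows "of_nat (card {y. y ^ n = a}) = 1 + (\<Sum>j = 1..<n. char_pow \<chi> j a)"
proof -
  have n: "n > 0" using assms(2) by (simp add: char_has_order_def)
  consider "a = 0" | "a \<noteq> 0" "\<chi> a \<noteq> 1" | "a \<noteq> 0" "\<chi> a = 1" by auto
  thus ?thesis
  proof cases
    case 1
    thus ?thesis using n by (simp add: char_pow_def)
  next
    case 2
    have "{y. y ^ n = a} = {}"
    proof (safe)
      fix y assume "a = y ^ n"
      moreover from this have "y \<noteq> 0" using 2 n by auto
      ultimately show "y \<in> {}"
        using 2 char_pow_order_eq_1[OF assms(2), of y] assms(1) by (simp add: mult_chars_power)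
    qed
    moreover have "1 + (\<Sum>j = 1..<n. char_pow \<chi> j a) = (\<Sum>j<n. \<chi> a ^ j)"
      using 2 n by (simp add: char_pow_def lessThan_atLeast0 sum.atLeast_Suc_lessThan)
    moreover have "(\<Sum>j<n. \<chi> a ^ j) = 0"
      using 2 char_pow_order_eq_1[OF assms(2), of a] by (simp add: geometric_sum)
    ultimately show ?thesis by simp
  next
    case 3
    obtain g :: 'a where g: "g \<noteq> 0" "bij_betw (\<lambda>i. g ^ i) {..<CARD('a) - 1} (UNIV - {0})"
      by (rule finite_field_generator_bij)
    let ?N = "CARD('a) - 1"
    have gen: "\<exists>i<?N. x = g ^ i" if "x \<noteq> 0" for x
      using g(2) that unfolding bij_betw_def by (metis Diff_iff UNIV_I imageE lessThan_iff singletonD)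
    \<comment> \<open>As \<open>\<chi>\<close> has order exactly \<open>n\<close>, its value at the
      generator is a primitive \<open>n\<close>-th root of unity.\<close>
    have dvd: "n dvd k" if "\<chi> g ^ k = 1" for k
    proof -
      have "char_pow \<chi> k = triv_char"
      proof
        fix x show "char_pow \<chi> k x = triv_char x"
        proof (cases "x = 0")
          case False
          then obtain i where "x = g ^ i" using gen by blast
          hence "\<chi> x ^ k = (\<chi> g ^ k) ^ i"
            using assms(1) by (simp add: mult_chars_power power_mult[symmetric] mult.commute)
          thus ?thesis using that False by (simp add: char_pow_def triv_char_def)
        qed (simp add: char_pow_def triv_char_def)
      qed
      thus ?thesis using char_pow_eq_triv_iff[OF assms(2)] by simp
    qed
    have pre: "\<exists>b. b \<noteq> 0 \<and> x = b ^ n" if x: "x \<noteq> 0" "\<chi> x = 1" for x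
    proof -
      obtain i where i: "x = g ^ i" using gen x by blast
      hence "n dvd i" using dvd x assms(1) by (simp add: mult_chars_power)
      then obtain l where "i = l * n" by (metis dvdE mult.commute)
      thus ?thesis using i g(1) by (auto simp: power_mult intro!: exI[of _ "g ^ l"])
    qed
    obtain b where b: "b \<noteq> 0" "a = b ^ n" using pre 3 by blast
    have "n dvd ?N"
      using dvd[of ?N] finite_field_power_card_minus_1[OF g(1)] assms(1)
      by (simp add: mult_chars_power[symmetric] mult_chars_1)
    then obtain l where l: "?N = n * l" by (elim dvdE)
    have N: "?N > 0" using finite_field_card_gt_1[where 'a = 'a] by simp
    hence l0: "l > 0" using l by (intro Nat.gr0I) auto
    \<comment> \<open>\<open>g ^ l\<close> is a primitive \<open>n\<close>-th root of unity in the
      finite field, so one root \<open>b\<close> produces \<open>n\<close> of them; the degree of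
      \<open>y^n - a\<close> allows no more.\<close>
    let ?z = "\<lambda>j. b * (g ^ l) ^ j"
    have roots: "?z j ^ n = a" for j
    proof -
      have "?z j ^ n = b ^ n * (g ^ ?N) ^ j"
        unfolding l by (simp add: power_mult_distrib power_mult[symmetric] mult_ac)
      thus ?thesis using finite_field_power_card_minus_1[OF g(1)] b by simp
    qed
    have "inj_on ?z {..<n}"
    proof (rule inj_onI)
      fix i j assume *: "i \<in> {..<n}" "j \<in> {..<n}" "?z i = ?z j"
      hence "g ^ (l * i) = g ^ (l * j)" using b(1) by (simp add: power_mult)
      moreover have "l * i < ?N" "l * j < ?N" using * l0 unfolding l by (auto simp: mult.commute)
      ultimately have "l * i = l * j" using g(2) unfolding bij_betw_def inj_on_def by blast
      thus "i = j" using l0 by simp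
    qed
    hence "card (?z ` {..<n}) = n" by (simp add: card_image)
    moreover have "card (?z ` {..<n}) \<le> card {y. y ^ n = a}"
      by (rule card_mono) (use roots in auto)
    moreover have "card {y. y ^ n = a} \<le> n"
    proof -
      define p where "p = Polynomial.monom 1 n - [:a:]"
      have deg: "Polynomial.degree p = n" unfolding p_def diff_conv_add_uminus
        using n by (subst degree_add_eq_left) (auto simp: Polynomial.degree_monom_eq)
      have "p \<noteq> 0" using deg n by auto
      hence "card {y. poly p y = 0} \<le> n" using card_poly_roots_bound[of p] deg by simp
      thus ?thesis by (simp add: p_def Polynomial.poly_monom)
    qed
    ultimately have "card {y. y ^ n = a} = n" by simp
    moreover have "(\<Sum>j = 1..<n. char_pow \<chi> j a) = of_nat (n - 1)"
      using 3 by (simp add: char_pow_def)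
    ultimately show ?thesis using n by (simp add: of_nat_diff)
  qed
qed

section \<open>Gauss and Jacobi sums\<close>

lemma sum_PiE_singleton:
  fixes f :: "'b::finite \<Rightarrow> 'w::comm_monoid_add"
  shows "(\<Sum>u\<in>{i} \<rightarrow>\<^sub>E UNIV. f (u i)) = (\<Sum>x\<in>UNIV. f x)"
  by (rule sum.reindex_bij_witness[where j = "\<lambda>u. u i" and i = "\<lambda>x. \<lambda>k\<in>{i}. x"])
     (auto simp: PiE_iff extensional_def fun_eq_iff)

lemma gauss_sum_UNIV:
  "\<eta> \<in> mult_chars \<Longrightarrow> gauss_sum \<phi> \<eta> = (\<Sum>x\<in>UNIV. \<phi> x * \<eta> x)"
  unfolding gauss_sum_def by (rule sum.mono_neutral_left) (auto simp: mult_chars_0)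

lemma sum_nontrivial_add_char:
  fixes \<phi> :: "'a::{field,finite} \<Rightarrow> 'w::field"
  assumes "nontrivial_add_char \<phi>"
  shows "(\<Sum>x\<in>UNIV. \<phi> x) = 0"
proof -
  obtain c where c: "\<phi> c \<noteq> 1" using assms by (auto simp: nontrivial_add_char_def)
  have "(\<Sum>x\<in>UNIV. \<phi> x) = (\<Sum>x\<in>UNIV. \<phi> (c + x))"
    by (rule sum.reindex_bij_witness[where j = "\<lambda>y. y - c" and i = "\<lambda>y. c + y"]) auto
  also have "\<dots> = \<phi> c * (\<Sum>x\<in>UNIV. \<phi> x)"
    using assms by (simp add: nontrivial_add_char_def sum_distrib_left)
  finally show ?thesis using c by simp
qed

lemma gauss_sum_triv_char:
  assumes "nontrivial_add_char \<phi>"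
  shows "gauss_sum \<phi> triv_char = -1"
proof -
  have "gauss_sum \<phi> triv_char = (\<Sum>x\<in>UNIV - {0}. \<phi> x)"
    by (simp add: gauss_sum_def triv_char_def)
  also have "\<dots> = (\<Sum>x\<in>UNIV. \<phi> x) - \<phi> 0" by (simp add: sum_diff1)
  finally show ?thesis
    using sum_nontrivial_add_char[OF assms] assms by (simp add: nontrivial_add_char_def)
qed

lemma add_char_sum:
  "nontrivial_add_char \<phi> \<Longrightarrow> \<phi> (\<Sum>i\<in>I. f i) = (\<Prod>i\<in>I. \<phi> (f i))"
  by (induction I rule: infinite_finite_induct) (auto simp: nontrivial_add_char_def)

text \<open>The additive convolution at \<open>t\<close> of all the \<open>A i\<close> and
  \<open>B\<close>; the argument of \<open>B\<close> is eliminated by requiring that all arguments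
  add up to \<open>t\<close>. For \<open>t = 1\<close> it is the Jacobi sum in several
  characters.\<close>

definition jacobi_conv ::
  "'i set \<Rightarrow> ('i \<Rightarrow> 'a::{field,finite} \<Rightarrow> 'w::field) \<Rightarrow> ('a \<Rightarrow> 'w) \<Rightarrow> 'a \<Rightarrow> 'w" where
  "jacobi_conv I A B t =
     (\<Sum>u\<in>I \<rightarrow>\<^sub>E UNIV. (\<Prod>i\<in>I. A i (u i)) * B (t - (\<Sum>i\<in>I. u i)))"

text \<open>Homogeneity, by substituting \<open>c * u i\<close> for \<open>u i\<close>.\<close>

lemma jacobi_conv_scale:
  assumes "\<And>i. i \<in> I \<Longrightarrow> A i \<in> mult_chars" "B \<in> mult_chars" "c \<noteq> 0"
  shows "jacobi_conv I A B (c * t) = (B c * (\<Prod>i\<in>I. A i c)) * jacobi_conv I A B t"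
proof -
  have "jacobi_conv I A B (c * t) =
      (\<Sum>u\<in>I \<rightarrow>\<^sub>E UNIV. (\<Prod>i\<in>I. A i (c * u i)) * B (c * t - (\<Sum>i\<in>I. c * u i)))"
    unfolding jacobi_conv_def
    by (rule sum.reindex_bij_witness[where j = "\<lambda>u. \<lambda>i\<in>I. u i / c" and i = "\<lambda>u. \<lambda>i\<in>I. c * u i"])
       (use assms(3) in \<open>auto simp: PiE_iff extensional_def fun_eq_iff\<close>)
  also have "\<dots> = (\<Sum>u\<in>I \<rightarrow>\<^sub>E UNIV. (B c * (\<Prod>i\<in>I. A i c)) *
      ((\<Prod>i\<in>I. A i (u i)) * B (t - (\<Sum>i\<in>I. u i))))"
  proof (rule sum.cong)
    fix u
    have "c * t - (\<Sum>i\<in>I. c * u i) = c * (t - (\<Sum>i\<in>I. u i))"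
      by (simp add: right_diff_distrib sum_distrib_left)
    thus "(\<Prod>i\<in>I. A i (c * u i)) * B (c * t - (\<Sum>i\<in>I. c * u i)) =
      (B c * (\<Prod>i\<in>I. A i c)) * ((\<Prod>i\<in>I. A i (u i)) * B (t - (\<Sum>i\<in>I. u i)))"
      using assms by (simp add: mult_chars_mult prod.distrib)
  qed simp
  finally show ?thesis by (simp add: jacobi_conv_def sum_distrib_left)
qed

text \<open>The additive Fourier transform takes convolutions to products, and the transform of a
  multiplicative character is its Gauss sum.\<close>

lemma sum_add_char_jacobi_conv:
  assumes "finite I" "\<And>i. i \<in> I \<Longrightarrow> A i \<in> mult_chars" "B \<in> mult_chars" "nontrivial_add_char \<phi>"
  shows "(\<Sum>t\<in>UNIV. \<phi> t * jacobi_conv I A B t) = (\<Prod>i\<in>I. gauss_sum \<phi> (A i)) * gauss_sum \<phi> B"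
proof -
  have inner: "(\<Sum>t\<in>UNIV. \<phi> t * B (t - c)) = \<phi> c * gauss_sum \<phi> B" for c
  proof -
    have "(\<Sum>t\<in>UNIV. \<phi> t * B (t - c)) = (\<Sum>t\<in>UNIV. \<phi> (c + t) * B t)"
      by (rule sum.reindex_bij_witness[where j = "\<lambda>t. t - c" and i = "\<lambda>t. c + t"]) auto
    thus ?thesis using assms
      by (simp add: gauss_sum_UNIV nontrivial_add_char_def sum_distrib_left mult_ac)
  qed
  have "(\<Sum>t\<in>UNIV. \<phi> t * jacobi_conv I A B t) =
      (\<Sum>u\<in>I \<rightarrow>\<^sub>E UNIV. \<Sum>t\<in>UNIV. \<phi> t * ((\<Prod>i\<in>I. A i (u i)) * B (t - (\<Sum>i\<in>I. u i))))"
    unfolding jacobi_conv_def sum_distrib_left by (rule sum.swap)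
  also have "\<dots> = (\<Sum>u\<in>I \<rightarrow>\<^sub>E UNIV. (\<Prod>i\<in>I. A i (u i)) * (\<phi> (\<Sum>i\<in>I. u i) * gauss_sum \<phi> B))"
    by (intro sum.cong refl, subst inner[symmetric], subst sum_distrib_left) (simp add: mult_ac)
  also have "\<dots> = (\<Sum>u\<in>I \<rightarrow>\<^sub>E UNIV. \<Prod>i\<in>I. \<phi> (u i) * A i (u i)) * gauss_sum \<phi> B"
    unfolding sum_distrib_right by (intro sum.cong refl) (simp add: add_char_sum[OF assms(4)] prod.distrib mult_ac)
  also have "(\<Sum>u\<in>I \<rightarrow>\<^sub>E UNIV. \<Prod>i\<in>I. \<phi> (u i) * A i (u i)) = (\<Prod>i\<in>I. gauss_sum \<phi> (A i))"
    using prod_sum_PiE[of I "\<lambda>_. UNIV" "\<lambda>i x. \<phi> x * A i x"] assms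
    by (simp add: gauss_sum_UNIV)
  finally show ?thesis .
qed

text \<open>By homogeneity the convolution is a multiple of \<open>C\<close>, and the multiple is read off from its
  additive Fourier transform.\<close>

lemma jacobi_conv_gauss_sum:
  assumes "finite I" "\<And>i. i \<in> I \<Longrightarrow> A i \<in> mult_chars" "B \<in> mult_chars" "nontrivial_add_char \<phi>"
    and C: "\<And>x. C x = B x * (\<Prod>i\<in>I. A i x)" and "C \<noteq> triv_char"
  shows "gauss_sum \<phi> C * jacobi_conv I A B t =
    C t * ((\<Prod>i\<in>I. gauss_sum \<phi> (A i)) * gauss_sum \<phi> B)"
proof -
  have CM: "C \<in> mult_chars"
    using assms(2,3) by (auto simp: mult_chars_def C prod.distrib prod.neutral)
  have scale: "jacobi_conv I A B (c * t) = C c * jacobi_conv I A B t" if "c \<noteq> 0" for c t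
    using jacobi_conv_scale[of I A B c t] assms that by (simp add: C)
  obtain c where c: "c \<noteq> 0" "C c \<noteq> 1" using mult_chars_nontrivialE[OF CM assms(6)] .
  \<comment> \<open>At \<open>t = 0\<close> homogeneity says that the value is fixed by
    multiplication with \<open>C c \<noteq> 1\<close>.\<close>
  have zero: "jacobi_conv I A B 0 = 0" using scale[OF c(1), of 0] c(2) by simp
  have T: "jacobi_conv I A B t = C t * jacobi_conv I A B 1" for t
    using scale[of t 1] zero CM by (cases "t = 0") (auto simp: mult_chars_0)
  have "(\<Prod>i\<in>I. gauss_sum \<phi> (A i)) * gauss_sum \<phi> B = gauss_sum \<phi> C * jacobi_conv I A B 1"
  proof -
    have "(\<Sum>t\<in>UNIV. \<phi> t * jacobi_conv I A B t) = (\<Sum>t\<in>UNIV. \<phi> t * C t * jacobi_conv I A B 1)"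
      by (rule sum.cong[OF refl], subst T) (simp only: mult.assoc)
    moreover have "(\<Sum>t\<in>UNIV. \<phi> t * jacobi_conv I A B t) =
        (\<Prod>i\<in>I. gauss_sum \<phi> (A i)) * gauss_sum \<phi> B"
      by (rule sum_add_char_jacobi_conv) (use assms in auto)
    ultimately show ?thesis by (simp only: gauss_sum_UNIV[OF CM] sum_distrib_right)
  qed
  thus ?thesis using T[of t] by (simp add: mult_ac)
qed

lemma jacobi_conv_singleton:
  "jacobi_conv {i} A B t = (\<Sum>u\<in>UNIV. A i u * B (t - u))"
  unfolding jacobi_conv_def
  using sum_PiE_singleton[of "\<lambda>u. A i u * B (t - u)" i] by simp

text \<open>When the product of the two characters is trivial, homogeneity only makes the
  convolution \<open>T\<close> constant away from 0. Its value at 0 is explicit and its total sum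
  vanishes because \<open>B\<close> is nontrivial; this determines \<open>T 1\<close>, the Jacobi
  sum.\<close>

lemma
  fixes A B :: "'a::{field,finite} \<Rightarrow> 'w::field_char_0"
  assumes "A \<in> mult_chars" "B \<in> mult_chars" "nontrivial_add_char \<phi>"
    and AB: "char_mult A B = triv_char" and "B \<noteq> triv_char"
  shows gauss_sum_mult_inverse: "gauss_sum \<phi> A * gauss_sum \<phi> B = of_nat CARD('a) * B (-1)"
    and jacobi_sum_inverse: "(\<Sum>x\<in>UNIV. A x * B (1 - x)) = - B (-1)"
proof -
  \<comment> \<open>The index set \<open>{()}\<close> leaves the single character \<open>A\<close>
    to be convolved with \<open>B\<close>.\<close>
  define T where "T = jacobi_conv {()} (\<lambda>_. A) B"
  define q where "q = (of_nat CARD('a) :: 'w)"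
  have q1: "q - 1 \<noteq> 0"
    using finite_field_card_gt_1[where 'a = 'a] by (simp add: q_def)
  have T: "T t = (\<Sum>u\<in>UNIV. A u * B (t - u))" for t
    by (simp add: T_def jacobi_conv_singleton)
  have AB1: "A x * B x = 1" if "x \<noteq> 0" for x
    using fun_cong[OF AB, of x] that by (simp add: char_mult_def triv_char_def)
  have T1: "T t = T 1" if "t \<noteq> 0" for t
    using jacobi_conv_scale[of "{()}" "\<lambda>_. A" B t 1] assms that AB1[OF that]
    by (simp add: T_def mult.commute)
  have "T 0 = (\<Sum>u\<in>UNIV. B (-1) * triv_char (u::'a))"
    unfolding T
  proof (intro sum.cong refl)
    fix u
    have "B (0 - u) = B (-1) * B u" using mult_chars_mult[OF assms(2), of "-1" u] by simp
    thus "A u * B (0 - u) = B (-1) * triv_char u"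
      using fun_cong[OF AB, of u] by (simp add: char_mult_def mult_ac)
  qed
  hence T0: "T 0 = B (-1) * (q - 1)"
    by (simp add: sum_distrib_left[symmetric] sum_triv_char q_def)
  \<comment> \<open>Used twice: \<open>f = 1\<close> yields \<open>T 1\<close>, and
    \<open>f = \<phi>\<close> yields the product of the Gauss sums.\<close>
  have split: "(\<Sum>t\<in>UNIV. f t * T t) = f 0 * T 0 + (\<Sum>t\<in>UNIV - {0}. f t) * T 1" for f
  proof -
    have "(\<Sum>t\<in>UNIV. f t * T t) = f 0 * T 0 + (\<Sum>t\<in>UNIV - {0}. f t * T t)"
      by (rule sum.remove) auto
    also have "(\<Sum>t\<in>UNIV - {0}. f t * T t) = (\<Sum>t\<in>UNIV - {0}. f t * T 1)"
      by (rule sum.cong[OF refl], subst T1) auto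
    finally show ?thesis by (simp add: sum_distrib_right)
  qed
  have "(\<Sum>t\<in>UNIV. T t) = (\<Sum>u\<in>UNIV. \<Sum>t\<in>UNIV. A u * B (t - u))"
    unfolding T by (rule sum.swap)
  also have "\<dots> = 0"
  proof (rule sum.neutral, safe)
    fix u
    have "(\<Sum>t\<in>UNIV. B (t - u)) = (\<Sum>t\<in>UNIV. B t)"
      by (rule sum.reindex_bij_witness[where j = "\<lambda>t. t - u" and i = "\<lambda>t. t + u"]) auto
    thus "(\<Sum>t\<in>UNIV. A u * B (t - u)) = 0"
      using sum_nontrivial_mult_char[OF assms(2,5)] by (simp add: sum_distrib_left[symmetric])
  qed
  finally have "T 0 + (q - 1) * T 1 = 0"
    using split[of "\<lambda>_. 1"] finite_field_card_gt_1[where 'a = 'a]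
    by (simp add: card_Diff_singleton of_nat_diff q_def)
  hence "(q - 1) * (T 1 + B (-1)) = 0" by (simp add: T0 algebra_simps)
  hence T1': "T 1 = - B (-1)" using q1 by (simp add: eq_neg_iff_add_eq_0)
  thus "(\<Sum>x\<in>UNIV. A x * B (1 - x)) = - B (-1)" by (simp add: T)
  have "gauss_sum \<phi> A * gauss_sum \<phi> B = (\<Sum>t\<in>UNIV. \<phi> t * T t)"
    unfolding T_def using sum_add_char_jacobi_conv[of "{()}" "\<lambda>_. A" B \<phi>] assms by simp
  also have "\<dots> = \<phi> 0 * T 0 + (\<Sum>t\<in>UNIV - {0}. \<phi> t) * T 1" by (rule split)
  also have "(\<Sum>t\<in>UNIV - {0}. \<phi> t) = -1"
    using gauss_sum_triv_char[OF assms(3)] by (simp add: gauss_sum_def triv_char_def)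
  also have "\<phi> 0 = 1" using assms(3) by (simp add: nontrivial_add_char_def)
  finally show "gauss_sum \<phi> A * gauss_sum \<phi> B = of_nat CARD('a) * B (-1)"
    by (simp add: T0 T1' q_def algebra_simps)
qed

text \<open>Multiplied by the Gauss sum of the inverse character it gives \<open>CARD('a)\<close>
  times a nonzero value.\<close>

lemma gauss_sum_nonzero:
  fixes B :: "'a::{field,finite} \<Rightarrow> 'w::field_char_0"
  assumes "B \<in> mult_chars" "nontrivial_add_char \<phi>"
  shows "gauss_sum \<phi> B \<noteq> 0"
proof (cases "B = triv_char")
  case False
  define A where "A x = inverse (B x)" for x
  have A: "A \<in> mult_chars" using assms(1) by (auto simp: mult_chars_def A_def)
  have "char_mult A B = triv_char"
    using assms(1) by (auto simp: char_mult_def triv_char_def A_def fun_eq_iff mult_chars_eq_0_iff mult_chars_0)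
  hence "gauss_sum \<phi> A * gauss_sum \<phi> B = of_nat CARD('a) * B (-1)"
    using gauss_sum_mult_inverse[OF A assms] False by simp
  thus ?thesis using assms(1) by (auto simp: mult_chars_eq_0_iff)
qed (use gauss_sum_triv_char[OF assms(2)] in simp)

text \<open>The power of \<open>CARD('a)\<close> unites two formulas. If the product character is
  trivial, its Gauss sum is -1 and the Jacobi sum is \<open>- B (-1)\<close>, so the extra factor
  restores \<open>CARD('a) * B (-1)\<close>.\<close>

lemma jacobi_sum_gauss_sum:
  fixes A B :: "'a::{field,finite} \<Rightarrow> 'w::field_char_0"
  assumes "A \<in> mult_chars" "B \<in> mult_chars" "nontrivial_add_char \<phi>" "B \<noteq> triv_char"
  shows "gauss_sum \<phi> A * gauss_sum \<phi> B =
    gauss_sum \<phi> (char_mult A B) * of_nat CARD('a) ^ of_bool (char_mult A B = triv_char) *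
    (\<Sum>x\<in>UNIV. A x * B (1 - x))"
proof (cases "char_mult A B = triv_char")
  case True
  thus ?thesis using assms
    by (simp add: gauss_sum_triv_char gauss_sum_mult_inverse jacobi_sum_inverse)
next
  case False
  thus ?thesis
    using jacobi_conv_gauss_sum[of "{()}" "\<lambda>_. A" B \<phi> "char_mult A B" 1] assms
      mult_chars_1[OF char_mult_in[OF assms(1,2)]]
    by (simp add: jacobi_conv_singleton char_mult_def mult_ac)
qed

section \<open>Residues modulo \<open>n\<close> and the missing and repeated entries of
  \<open>s\<close>\<close>

lemma rep1_ge_1:
  assumes "n > 0"
  shows "rep1 n a \<ge> 1"
proof -
  have "(a - 1) mod int n \<ge> 0" using assms by simp
  thus ?thesis unfolding rep1_def by linarith
qed

lemma rep1_cong: "n > 0 \<Longrightarrow> [int (rep1 n a) = a] (mod int n)"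
  by (simp add: rep1_def cong_def mod_simps)

text \<open>A product over an index family depends only on the multiset of its values, so one
  multiset identity serves for products and sums alike.\<close>

lemma prod_unfold_image_mset:
  "(\<Prod>i\<in>I. G (f i)) = prod_mset (image_mset G (image_mset f (mset_set I)))"
  by (simp add: prod_unfold_prod_mset image_mset.compositionality o_def)

lemma sum_unfold_image_mset:
  "(\<Sum>i\<in>I. G (f i)) = sum_mset (image_mset G (image_mset f (mset_set I)))"
  by (simp add: sum_unfold_sum_mset image_mset.compositionality o_def)

lemma char_pow_cong:
  assumes "char_has_order \<chi> n" "[i = j] (mod n)"
  shows "char_pow \<chi> i = char_pow \<chi> j"
  using char_power_cong[OF assms] by (auto simp: char_pow_def)

text \<open>Nothing here involves characters, so the results remain available for every power of
  \<open>\<chi>\<close>. The multiplicity \<open>k b\<close> appears as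
  \<open>count (mset s) b\<close>.\<close>

locale multiplicity_data =
  fixes n m m1 :: nat and s :: "nat list" and v w :: "nat \<Rightarrow> nat"
  assumes prime_n: "prime n" and n_ge_5: "n \<ge> 5"
    and s_in: "s \<in> tuples n" and sum_s: "[sum_list s = 0] (mod n)"
    and bij_v: "bij_betw v {1..m} {b. b < n \<and> b \<notin> set s}"
    and w: "\<And>i. i \<in> {1..m} \<Longrightarrow> w i < n \<and> count (mset s) (w i) \<ge> 2"
    and card_w: "\<And>b. b < n \<Longrightarrow> count (mset s) b \<ge> 2 \<Longrightarrow>
      card {i \<in> {1..m}. w i = b} = count (mset s) b - 1"
    and even_m1: "even m1" and m1_le: "m1 + 2 \<le> m"
    and pairs: "\<And>i. 1 \<le> i \<Longrightarrow> i \<le> m1 div 2 \<Longrightarrow>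
      [int (w (2 * i - 1)) - int (v (2 * i - 1)) = - (int (w (2 * i)) - int (v (2 * i)))] (mod int n)"
begin

lemma n_pos: "n > 0" and odd_n: "odd n"
  using prime_n n_ge_5 prime_odd_nat by (auto simp: prime_gt_0_nat)

lemma length_s: "length s = n" and set_s: "set s \<subseteq> {..<n}"
  using s_in by (auto simp: tuples_def)

lemma v: "i \<in> {1..m} \<Longrightarrow> v i < n \<and> v i \<notin> set s"
  using bij_v by (auto simp: bij_betw_def)

lemma w_in: "i \<in> {1..m} \<Longrightarrow> w i \<in> set s"
  using w[of i] by (metis count_mset_0_iff not_numeral_le_zero)

text \<open>A residue of multiplicity \<open>k\<close> in \<open>s\<close> is counted
  \<open>1 + (k - 1)\<close> times on the left, with truncated subtraction, and
  \<open>k + of_bool (k = 0)\<close> times on the right.\<close>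

lemma mset_eq:
  "image_mset (\<lambda>b. b) (mset_set {..<n}) + image_mset w (mset_set {1..m}) =
   image_mset (\<lambda>i. s ! i) (mset_set {..<n}) + image_mset v (mset_set {1..m})"
proof (rule multiset_eqI)
  fix b
  have s: "image_mset (\<lambda>i. s ! i) (mset_set {..<n}) = mset s"
    using length_s by (metis lessThan_atLeast0 map_nth mset_map mset_upt)
  have cv: "card {i\<in>{1..m}. v i = b} = of_bool (b < n \<and> b \<notin> set s)"
  proof (cases "b < n \<and> b \<notin> set s")
    case True
    then obtain i where i: "i \<in> {1..m}" "b = v i" using bij_v unfolding bij_betw_def by blast
    moreover have "inj_on v {1..m}" using bij_v by (simp add: bij_betw_def)
    ultimately have "{i\<in>{1..m}. v i = b} = {i}" unfolding inj_on_def by blast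
    thus ?thesis using True by (simp only: card_1_singleton_iff of_bool_eq simp_thms) simp
  next
    case False
    hence "{i\<in>{1..m}. v i = b} = {}" using v by auto
    thus ?thesis using False by (simp only: card.empty of_bool_eq)
  qed
  have cw: "card {i\<in>{1..m}. w i = b} = count (mset s) b - 1"
  proof (cases "b < n \<and> count (mset s) b \<ge> 2")
    case False
    hence "{i\<in>{1..m}. w i = b} = {}" using w by auto
    moreover have "count (mset s) b \<le> 1"
      using False set_s by (metis One_nat_def Suc_1 count_mset_0_iff lessThan_iff not_less_eq_eq subsetD zero_le_one)
    ultimately show ?thesis by (simp only: card.empty)
  qed (use card_w in simp)
  have "b < n" if "b \<in> set s" using that set_s by auto
  moreover have "count (mset s) b = 0" if "b \<notin> set s" using that by (simp add: count_eq_zero_iff)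
  moreover have "\<exists>c. count (mset s) b = Suc c" if "b \<in> set s"
    using that by (metis count_mset_0_iff not0_implies_Suc)
  ultimately show "count (image_mset (\<lambda>b. b) (mset_set {..<n}) + image_mset w (mset_set {1..m})) b =
    count (image_mset (\<lambda>i. s ! i) (mset_set {..<n}) + image_mset v (mset_set {1..m})) b"
    unfolding s count_union count_image_mset_eq_card_vimage[OF finite_atLeastAtMost] cv cw
    by (cases "b < n"; cases "b \<in> set s") (auto simp: count_mset_set' simp del: count_mset_0_iff)
qed

text \<open>With Gauss sums for \<open>G\<close> this cancels the common factors in
  \<open>beta\<close>: only the missing residues remain above and the surplus ones below.\<close>

lemma prod_v_w:
  "(\<Prod>b<n. G b) * (\<Prod>i = 1..m. G (w i)) = (\<Prod>i<n. G (s ! i)) * (\<Prod>i = 1..m. G (v i))"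
  unfolding prod_unfold_image_mset[of G "\<lambda>b. b"] prod_unfold_image_mset[of G w]
    prod_unfold_image_mset[of G v] prod_unfold_image_mset[of G "\<lambda>i. s ! i"]
    prod_mset_Un[symmetric] image_mset_union[symmetric] mset_eq ..

lemma sum_v_w:
  "(\<Sum>b<n. G b) + (\<Sum>i = 1..m. G (w i)) = (\<Sum>i<n. G (s ! i)) + (\<Sum>i = 1..m. G (v i))"
  unfolding sum_unfold_image_mset[of G "\<lambda>b. b"] sum_unfold_image_mset[of G w]
    sum_unfold_image_mset[of G v] sum_unfold_image_mset[of G "\<lambda>i. s ! i"]
    sum_mset.union[symmetric] image_mset_union[symmetric] mset_eq ..

text \<open>\<open>d\<close> and \<open>e\<close> use the representatives that occur in the equation
  of \<open>H\<close>, so that they match its exponents literally.\<close>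

definition d :: "nat \<Rightarrow> nat" where "d i = rep1 n (int (w i) - int (v i))"

definition e :: "nat \<Rightarrow> nat" where "e i = rep1 n (int (v i) - int (w i))"

lemma d_plus_v: "[v i + d i = w i] (mod n)"
proof -
  have "[int (v i) + int (d i) = int (v i) + (int (w i) - int (v i))] (mod int n)"
    unfolding d_def by (intro cong_add cong_refl rep1_cong n_pos)
  thus ?thesis by (simp flip: cong_int_iff)
qed

lemma d_plus_e: "[d i + e i = 0] (mod n)"
proof -
  have "[int (d i) + int (e i) = (int (w i) - int (v i)) + (int (v i) - int (w i))] (mod int n)"
    unfolding d_def e_def by (intro cong_add rep1_cong n_pos)
  thus ?thesis by (simp flip: cong_int_iff)
qed

text \<open>\<open>w i\<close> occurs in \<open>s\<close> and \<open>v i\<close> does not, so they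
  are different residues.\<close>

lemma not_dvd_d: "i \<in> {1..m} \<Longrightarrow> \<not> n dvd d i"
proof
  assume i: "i \<in> {1..m}" and "n dvd d i"
  hence "[v i + d i = v i] (mod n)" by (simp add: cong_add_lcancel_0_nat cong_0_iff)
  hence "[v i = w i] (mod n)" using d_plus_v[of i] by (metis cong_sym cong_trans)
  hence "v i = w i" using v[OF i] w[OF i] by (simp add: cong_less_modulus_unique_nat)
  thus False using v[OF i] w_in[OF i] by simp
qed

lemma not_dvd_e: "i \<in> {1..m} \<Longrightarrow> \<not> n dvd e i"
  using not_dvd_d[of i] d_plus_e[of i] by (metis cong_0_iff dvd_add_left_iff)

text \<open>The residues add up to 0 because \<open>n\<close> is odd, and so do the entries of
  \<open>s\<close> by hypothesis; \<open>sum_v_w\<close> then equates the sums of the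
  \<open>v i\<close> and the \<open>w i\<close>.\<close>

lemma sum_d: "[(\<Sum>i = 1..m. d i) = 0] (mod n)"
proof -
  have dvd_id: "n dvd (\<Sum>b<n. b)"
  proof -
    have "2 * (\<Sum>b<n. b) = n * (n - 1)"
      by (induction n) (auto simp: algebra_simps)
    hence "n dvd 2 * (\<Sum>b<n. b)" by simp
    moreover have "coprime n 2" using odd_n by simp
    ultimately show ?thesis by (simp add: coprime_dvd_mult_right_iff)
  qed
  have "(\<Sum>i<n. s ! i) = sum_list s"
    using length_s by (simp add: sum_list_sum_nth lessThan_atLeast0)
  hence dvd_s: "n dvd (\<Sum>i<n. s ! i)" using sum_s by (simp add: cong_0_iff)
  have eq: "(\<Sum>b<n. b) + (\<Sum>i = 1..m. w i) = (\<Sum>i<n. s ! i) + (\<Sum>i = 1..m. v i)"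
    by (rule sum_v_w)
  have "[(\<Sum>b<n. b) + (\<Sum>i = 1..m. w i) = 0 + (\<Sum>i = 1..m. w i)] (mod n)"
    by (intro cong_add) (use dvd_id in \<open>auto simp: cong_0_iff\<close>)
  moreover have "[(\<Sum>i<n. s ! i) + (\<Sum>i = 1..m. v i) = 0 + (\<Sum>i = 1..m. v i)] (mod n)"
    by (intro cong_add) (use dvd_s in \<open>auto simp: cong_0_iff\<close>)
  ultimately have wv: "[(\<Sum>i = 1..m. w i) = (\<Sum>i = 1..m. v i)] (mod n)"
    unfolding eq by (simp add: cong_def)
  have "[(\<Sum>i = 1..m. v i + d i) = (\<Sum>i = 1..m. w i)] (mod n)"
    by (intro cong_sum d_plus_v)
  hence "[(\<Sum>i = 1..m. v i) + (\<Sum>i = 1..m. d i) = (\<Sum>i = 1..m. v i)] (mod n)"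
    using wv by (metis cong_trans sum.distrib)
  thus ?thesis by (simp add: cong_add_lcancel_0_nat)
qed

lemma d_pair:
  assumes "1 \<le> i" "i \<le> m1 div 2"
  shows "[d (2 * i - 1) + d (2 * i) = 0] (mod n)"
proof -
  have "[int (d (2 * i - 1)) + int (d (2 * i)) =
    - (int (w (2 * i)) - int (v (2 * i))) + (int (w (2 * i)) - int (v (2 * i)))] (mod int n)"
    unfolding d_def
    by (intro cong_add rep1_cong n_pos cong_trans[OF rep1_cong[OF n_pos] pairs[OF assms]])
  thus ?thesis by (simp flip: cong_int_iff)
qed

text \<open>The paired \<open>d i\<close> cancel, so the remaining ones, including
  \<open>d m\<close>, add up to 0, and \<open>e i\<close> is the negative of \<open>d i\<close>.
  This makes the product of the characters with exponents \<open>e i\<close> equal to the one with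
  exponent \<open>d m\<close>.\<close>

lemma sum_e: "[(\<Sum>i = m1 + 1..m - 1. e i) = d m] (mod n)"
proof -
  have pair_sum: "[(\<Sum>i = 1..2 * l. d i) = 0] (mod n)" if "l \<le> m1 div 2" for l
    using that
  proof (induction l)
    case (Suc l)
    have "(\<Sum>i = 1..2 * Suc l. d i) = (\<Sum>i = 1..2 * l. d i) + (d (2 * Suc l - 1) + d (2 * Suc l))"
      by simp
    also have "[\<dots> = 0 + 0] (mod n)"
      by (intro cong_add Suc.IH d_pair) (use Suc.prems in auto)
    finally show ?case by simp
  qed simp
  have "{1..m} = {1..m1} \<union> {m1 + 1..m - 1} \<union> {m}" using m1_le by auto
  hence "(\<Sum>i = 1..m. d i) = (\<Sum>i = 1..m1. d i) + (\<Sum>i = m1 + 1..m - 1. d i) + d m"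
    using m1_le by (simp add: sum.union_disjoint)
  hence "n dvd (\<Sum>i = 1..m1. d i) + ((\<Sum>i = m1 + 1..m - 1. d i) + d m)"
    using sum_d by (simp add: cong_0_iff add.assoc)
  moreover have "n dvd (\<Sum>i = 1..m1. d i)"
    using pair_sum[of "m1 div 2"] even_m1 by (simp add: cong_0_iff)
  ultimately have 1: "[(\<Sum>i = m1 + 1..m - 1. d i) + d m = 0] (mod n)"
    by (simp add: cong_0_iff dvd_add_right_iff)
  have "[(\<Sum>i = m1 + 1..m - 1. d i + e i) = (\<Sum>i = m1 + 1..m - 1. 0)] (mod n)"
    by (intro cong_sum d_plus_e)
  hence 2: "[(\<Sum>i = m1 + 1..m - 1. d i) + (\<Sum>i = m1 + 1..m - 1. e i) = 0] (mod n)"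
    by (simp add: sum.distrib)
  show ?thesis using cong_trans[OF 2 cong_sym[OF 1]] by (simp add: cong_add_lcancel_nat)
qed

end

section \<open>Reduction of \<open>beta\<close> to Jacobi sums\<close>

locale character_data = multiplicity_data n m m1 s v w
  for n m m1 :: nat and s :: "nat list" and v w :: "nat \<Rightarrow> nat" +
  fixes \<phi> \<chi> :: "'a::{field,finite} \<Rightarrow> 'w::{alg_closed_field,field_char_0}"
  assumes \<phi>: "nontrivial_add_char \<phi>" and \<chi>: "\<chi> \<in> mult_chars" "char_has_order \<chi> n"
begin

lemma char_pow_nontrivial: "\<not> n dvd k \<Longrightarrow> char_pow \<chi> k \<noteq> triv_char"
  using char_pow_eq_triv_iff[OF \<chi>(2)] by simp

definition q :: 'w where "q = of_nat CARD('a)"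

lemma q_nonzero: "q \<noteq> 0" and q_minus_1_nonzero: "q - 1 \<noteq> 0"
  using finite_field_card_gt_1[where 'a = 'a] by (auto simp: q_def)

definition G :: "nat \<Rightarrow> 'w" where "G k = gauss_sum \<phi> (char_pow \<chi> k)"

lemma G_nonzero: "G k \<noteq> 0"
  unfolding G_def by (intro gauss_sum_nonzero char_pow_in \<chi> \<phi>)

text \<open>The order of \<open>\<chi> (-1)\<close> divides both 2 and the odd number
  \<open>n\<close>. Hence no sign appears in \<open>G_mult\<close>.\<close>

lemma chi_minus_1: "\<chi> (-1) = 1"
proof -
  have "\<chi> (-1) ^ n = 1" by (rule char_pow_order_eq_1[OF \<chi>(2)]) simp
  moreover have "\<chi> (-1) ^ 2 = 1"
    using mult_chars_power[OF \<chi>(1), of "-1" 2] mult_chars_1[OF \<chi>(1)] by simp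
  ultimately show ?thesis using odd_n by (metis odd_two_times_div_two_succ power_Suc2 power_add power_mult power_one mult_1 Suc_eq_plus1)
qed

lemma G_mult:
  assumes "[i + j = 0] (mod n)" "\<not> n dvd j"
  shows "G i * G j = q"
proof -
  have "char_mult (char_pow \<chi> i) (char_pow \<chi> j) = char_pow \<chi> (i + j)"
    by (auto simp: char_mult_def char_pow_def power_add)
  also have "\<dots> = triv_char" using assms(1) char_pow_eq_triv_iff[OF \<chi>(2)] by (simp add: cong_0_iff)
  finally have "G i * G j = of_nat CARD('a) * char_pow \<chi> j (-1)"
    unfolding G_def
    by (intro gauss_sum_mult_inverse char_pow_in \<chi> \<phi> char_pow_nontrivial assms(2))
  thus ?thesis by (simp add: char_pow_def chi_minus_1 q_def)
qed

definition J :: "('a \<Rightarrow> 'w) \<Rightarrow> nat \<Rightarrow> 'w" where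
  "J \<eta> i = (\<Sum>x\<in>UNIV. char_mult (char_pow \<chi> (v i)) \<eta> x * char_pow \<chi> (d i) (1 - x))"

text \<open>The characters of the Jacobi sum multiply to \<open>\<theta> (w i)\<close> by
  \<open>d_plus_v\<close>; the power of \<open>q\<close> records the case where that product is
  trivial.\<close>

lemma J_div_G:
  assumes "\<eta> \<in> mult_chars" "i \<in> {1..m}"
  defines "\<theta> \<equiv> \<lambda>b. char_mult (char_pow \<chi> b) \<eta>"
  shows "J \<eta> i / G (d i) = gauss_sum \<phi> (\<theta> (v i)) /
    (gauss_sum \<phi> (\<theta> (w i)) * q ^ of_bool (\<theta> (w i) = triv_char))"
proof -
  have in_mc: "\<theta> b \<in> mult_chars" for b
    unfolding \<theta>_def by (intro char_mult_in char_pow_in \<chi> assms(1))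
  have "char_mult (\<theta> (v i)) (char_pow \<chi> (d i)) = char_mult (char_pow \<chi> (v i + d i)) \<eta>"
    by (auto simp: \<theta>_def char_mult_def char_pow_def power_add)
  also have "\<dots> = \<theta> (w i)"
    unfolding \<theta>_def char_pow_cong[OF \<chi>(2) d_plus_v] ..
  finally have "gauss_sum \<phi> (\<theta> (v i)) * G (d i) =
      gauss_sum \<phi> (\<theta> (w i)) * q ^ of_bool (\<theta> (w i) = triv_char) * J \<eta> i"
    using jacobi_sum_gauss_sum[OF in_mc[of "v i"] char_pow_in[OF \<chi>(1), of "d i"] \<phi>
        char_pow_nontrivial[OF not_dvd_d[OF assms(2)]]]
    by (simp add: J_def G_def \<theta>_def q_def)
  thus ?thesis using G_nonzero gauss_sum_nonzero[OF in_mc \<phi>] q_nonzero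
    by (simp add: field_simps)
qed

text \<open>At most one residue \<open>b\<close> makes \<open>\<theta> b\<close> trivial. If it
  occurs in \<open>s\<close>, it does so once more often than among the \<open>w i\<close>. If it is
  missing from \<open>s\<close> or does not exist, both counts are 0 and the correction term
  supplies the 1.\<close>

lemma triv_count_eq:
  assumes "\<eta> \<in> mult_chars"
  defines "\<theta> \<equiv> \<lambda>b. char_mult (char_pow \<chi> b) \<eta>"
  shows "triv_count \<chi> s \<eta> + of_bool (triv_count \<chi> s \<eta> = 0) =
    1 + (\<Sum>i = 1..m. of_bool (\<theta> (w i) = triv_char))"
proof -
  define Z :: "nat \<Rightarrow> nat" where "Z b = of_bool (\<theta> b = triv_char)" for b
  have z: "triv_count \<chi> s \<eta> = (\<Sum>i<n. Z (s ! i))"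
    by (simp add: triv_count_def Z_def \<theta>_def length_s Int_def)
  have uniq: "b = c" if "b < n" "c < n" "\<theta> b = triv_char" "\<theta> c = triv_char" for b c
  proof -
    have le: "b = c" if *: "b \<le> c" "b < n" "c < n" "\<theta> b = triv_char" "\<theta> c = triv_char" for b c
    proof -
      have "char_pow \<chi> (c - b) = triv_char"
      proof
        fix x show "char_pow \<chi> (c - b) x = triv_char x"
        proof (cases "x = 0")
          case False
          have "\<chi> x ^ b * \<eta> x = 1" "\<chi> x ^ c * \<eta> x = 1"
            using False fun_cong[OF *(4), of x] fun_cong[OF *(5), of x]
            by (simp_all add: \<theta>_def char_mult_def char_pow_def triv_char_def)
          moreover have "\<chi> x ^ c = \<chi> x ^ (c - b) * \<chi> x ^ b" using *(1) by (simp flip: power_add)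
          ultimately have "\<chi> x ^ (c - b) = 1" by (metis mult.assoc mult_1_right)
          thus ?thesis using False by (simp add: char_pow_def triv_char_def)
        qed (simp add: char_pow_def triv_char_def)
      qed
      hence "n dvd c - b" using char_pow_eq_triv_iff[OF \<chi>(2)] by simp
      thus ?thesis using * by (metis diff_is_0_eq dvd_imp_le le_antisym less_imp_diff_less not_gr_zero not_less)
    qed
    show ?thesis using le[of b c] le[of c b] that by (cases "b \<le> c") auto
  qed
  show ?thesis
  proof (cases "\<exists>b<n. \<theta> b = triv_char")
    case False
    hence "Z b = 0" if "b < n" for b using that by (auto simp: Z_def)
    hence "(\<Sum>i<n. Z (s ! i)) = 0" "(\<Sum>i = 1..m. Z (w i)) = 0"
      using set_s length_s w by (auto simp: subset_iff)
    thus ?thesis unfolding z by (simp add: Z_def)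
  next
    case True
    then obtain b where b: "b < n" "\<theta> b = triv_char" by auto
    have Z: "Z c = of_bool (c = b)" if "c < n" for c
    proof (cases "c = b")
      case True
      thus ?thesis using b(2) by (simp add: Z_def)
    next
      case False
      hence "\<theta> c \<noteq> triv_char" using uniq that b by blast
      thus ?thesis using False by (simp add: Z_def)
    qed
    show ?thesis
    proof (cases "b \<in> set s")
      case True
      \<comment> \<open>The residue \<open>b\<close> occurs once among all residues and never among
        the \<open>v i\<close>, so \<open>sum_v_w\<close> relates its occurrences in
        \<open>s\<close> to those among the \<open>w i\<close>.\<close>
      have "(\<Sum>c<n. Z c) = 1" using b(1) by (simp add: Z)
      moreover have "Z (v i) = 0" if "i \<in> {1..m}" for i
        using v[OF that] Z[of "v i"] True by auto
      hence "(\<Sum>i = 1..m. Z (v i)) = 0" by simp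
      ultimately have eq: "1 + (\<Sum>i = 1..m. Z (w i)) = (\<Sum>i<n. Z (s ! i))"
        using sum_v_w[of Z] by simp
      hence "(\<Sum>i<n. Z (s ! i)) \<noteq> 0" by linarith
      with eq show ?thesis
        unfolding z Z_def[symmetric] by (simp only: of_bool_eq simp_thms add_0_right)
    next
      case False
      have "Z (s ! i) = 0" if "i < n" for i
      proof -
        have "s ! i \<in> set s" using that length_s by simp
        thus ?thesis using False Z[of "s ! i"] set_s by auto
      qed
      moreover have "Z (w i) = 0" if "i \<in> {1..m}" for i
        using w[OF that] w_in[OF that] False Z[of "w i"] by auto
      ultimately have "(\<Sum>i<n. Z (s ! i)) = 0" "(\<Sum>i = 1..m. Z (w i)) = 0" by auto
      thus ?thesis unfolding z by (simp add: Z_def)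
    qed
  qed
qed

text \<open>By \<open>triv_count_eq\<close> the exponent of \<open>q\<close> is
  \<open>(n - 1) div 2\<close> minus the number of \<open>i\<close> for which
  \<open>\<theta> (w i)\<close> is trivial, and each such \<open>i\<close> uses up the factor
  \<open>q\<close> in \<open>J_div_G\<close>.\<close>

lemma beta_eq:
  assumes "\<eta> \<in> mult_chars"
  shows "beta n \<phi> \<chi> s \<eta> = q ^ ((n - 1) div 2) * (\<Prod>i = 1..m. J \<eta> i / G (d i))"
proof -
  define \<theta> where "\<theta> b = char_mult (char_pow \<chi> b) \<eta>" for b
  define g where "g b = gauss_sum \<phi> (\<theta> b)" for b
  define Z where "Z = (\<Sum>i = 1..m. of_bool (\<theta> (w i) = triv_char) :: nat)"
  let ?z = "triv_count \<chi> s \<eta>"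
  have g0: "g b \<noteq> 0" for b
    unfolding g_def \<theta>_def by (intro gauss_sum_nonzero char_mult_in char_pow_in \<chi> assms \<phi>)
  have ratio: "(\<Prod>b<n. g b) / (\<Prod>i<n. g (s ! i)) = (\<Prod>i = 1..m. g (v i)) / (\<Prod>i = 1..m. g (w i))"
    using prod_v_w[of g] g0 by (simp add: field_simps)
  have "?z + of_bool (?z = 0) = 1 + Z"
    using triv_count_eq[OF assms] unfolding Z_def \<theta>_def .
  hence "int ?z + (if ?z \<noteq> 0 then 0 else 1) = 1 + int Z"
    by (cases "?z = 0") simp_all
  moreover have "int ((n + 1) div 2) = int ((n - 1) div 2) + 1"
    using odd_n by (auto elim!: oddE)
  ultimately have "int ((n + 1) div 2) - int ?z - (if ?z \<noteq> 0 then 0 else 1) = int ((n - 1) div 2) - int Z"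
    by linarith
  hence "beta n \<phi> \<chi> s \<eta> = q powi (int ((n - 1) div 2) - int Z) *
      ((\<Prod>i = 1..m. g (v i)) / (\<Prod>i = 1..m. g (w i)))"
    unfolding beta_def Let_def ratio[symmetric] by (simp add: g_def \<theta>_def q_def)
  also have "q powi (int ((n - 1) div 2) - int Z) = q ^ ((n - 1) div 2) / q ^ Z"
    using q_nonzero by (simp add: power_int_diff)
  also have "q ^ Z = (\<Prod>i = 1..m. q ^ of_bool (\<theta> (w i) = triv_char))"
    by (simp only: Z_def power_sum)
  also have "q ^ ((n - 1) div 2) / (\<Prod>i = 1..m. q ^ of_bool (\<theta> (w i) = triv_char)) *
      ((\<Prod>i = 1..m. g (v i)) / (\<Prod>i = 1..m. g (w i))) =
      q ^ ((n - 1) div 2) * (\<Prod>i = 1..m. g (v i) / (g (w i) * q ^ of_bool (\<theta> (w i) = triv_char)))"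
    by (simp add: prod_dividef prod.distrib)
  also have "(\<Prod>i = 1..m. g (v i) / (g (w i) * q ^ of_bool (\<theta> (w i) = triv_char))) =
      (\<Prod>i = 1..m. J \<eta> i / G (d i))"
    by (rule prod.cong) (auto simp: J_div_G[OF assms] g_def \<theta>_def)
  finally show ?thesis .
qed

end

text \<open>A function on a disjoint union is a pair of functions. This later joins the coordinates
  on the torus with the unconstrained ones.\<close>

lemma sum_PiE_Un:
  fixes f :: "('i \<Rightarrow> 'b::finite) \<Rightarrow> ('i \<Rightarrow> 'b) \<Rightarrow> 'w::comm_monoid_add"
  assumes "finite A" "finite B" "A \<inter> B = {}"
  shows "(\<Sum>y\<in>{y \<in> A \<rightarrow>\<^sub>E UNIV. Q y}. \<Sum>u\<in>B \<rightarrow>\<^sub>E UNIV. f y u) =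
    (\<Sum>x\<in>{x \<in> A \<union> B \<rightarrow>\<^sub>E UNIV. Q (restrict x A)}. f (restrict x A) (restrict x B))"
proof -
  let ?S = "{y \<in> A \<rightarrow>\<^sub>E UNIV. Q y} \<times> (B \<rightarrow>\<^sub>E UNIV)"
  define merge where "merge y u k = (if k \<in> A then y k else u k)" for y u :: "'i \<Rightarrow> 'b" and k
  have merge: "merge y u \<in> A \<union> B \<rightarrow>\<^sub>E UNIV" "restrict (merge y u) A = y" "restrict (merge y u) B = u"
    if "y \<in> A \<rightarrow>\<^sub>E UNIV" "u \<in> B \<rightarrow>\<^sub>E UNIV" for y u :: "'i \<Rightarrow> 'b"
    using that assms(3) by (auto simp: merge_def fun_eq_iff PiE_iff extensional_def restrict_def)
  have merge_restrict: "merge (restrict x A) (restrict x B) = x" if "x \<in> A \<union> B \<rightarrow>\<^sub>E UNIV" for x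
    using that by (auto simp: merge_def fun_eq_iff PiE_iff extensional_def restrict_def)
  have "(\<Sum>(y, u)\<in>?S. f y u) =
    (\<Sum>x\<in>{x \<in> A \<union> B \<rightarrow>\<^sub>E UNIV. Q (restrict x A)}. f (restrict x A) (restrict x B))"
    by (rule sum.reindex_bij_witness[where i = "\<lambda>x. (restrict x A, restrict x B)"
          and j = "\<lambda>(y, u). merge y u"])
       (auto simp: merge merge_restrict del: PiE_I)
  thus ?thesis by (simp add: sum.cartesian_product)
qed

section \<open>Character sums over the torus\<close>

text \<open>The coordinates in \<open>I - M\<close> are unconstrained. For \<open>I = M\<close> and
  nonzero \<open>c\<close> this is a coset of the torus of tuples with product 1.\<close>

definition torus_points :: "nat set \<Rightarrow> nat set \<Rightarrow> 'a::{field,finite} \<Rightarrow> (nat \<Rightarrow> 'a) set" where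
  "torus_points I M c = {x \<in> I \<rightarrow>\<^sub>E UNIV. (\<Prod>i\<in>M. x i) = c}"

text \<open>Averaging \<open>\<eta>\<close> of the product of the \<open>x i\<close> divided by
  \<open>c\<close> over all characters detects the condition on the product, and for fixed
  \<open>\<eta>\<close> the sum factors over the coordinates.\<close>

lemma sum_torus_points:
  fixes f :: "nat \<Rightarrow> 'a::{field,finite} \<Rightarrow> 'w::{alg_closed_field,field_char_0}"
  assumes "finite M" "c \<noteq> 0"
  shows "(of_nat CARD('a) - 1) * (\<Sum>x\<in>torus_points M M c. \<Prod>i\<in>M. f i (x i)) =
    (\<Sum>\<eta>\<in>mult_chars. (\<Prod>i\<in>M. \<Sum>x\<in>UNIV. f i x * \<eta> x) * \<eta> (1 / c))"
proof -
  have fin: "finite (M \<rightarrow>\<^sub>E (UNIV :: 'a set))" using assms(1) by (intro finite_PiE) auto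
  have "(\<Sum>\<eta>\<in>mult_chars. (\<Prod>i\<in>M. \<Sum>x\<in>UNIV. f i x * \<eta> x) * \<eta> (1 / c)) =
    (\<Sum>\<eta>\<in>mult_chars. \<Sum>x\<in>M \<rightarrow>\<^sub>E UNIV. (\<Prod>i\<in>M. f i (x i)) * \<eta> ((\<Prod>i\<in>M. x i) / c))"
  proof (rule sum.cong[OF refl])
    fix \<eta> :: "'a \<Rightarrow> 'w" assume \<eta>: "\<eta> \<in> mult_chars"
    have "(\<Prod>i\<in>M. \<Sum>x\<in>UNIV. f i x * \<eta> x) = (\<Sum>x\<in>M \<rightarrow>\<^sub>E UNIV. \<Prod>i\<in>M. f i (x i) * \<eta> (x i))"
      by (rule prod_sum_PiE) (use assms in auto)
    moreover have "\<eta> ((\<Prod>i\<in>M. x i) / c) = (\<Prod>i\<in>M. \<eta> (x i)) * \<eta> (1 / c)" for x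
      using mult_chars_mult[OF \<eta>, of "\<Prod>i\<in>M. x i" "1 / c"] by (simp add: mult_chars_prod[OF \<eta>])
    ultimately show "(\<Prod>i\<in>M. \<Sum>x\<in>UNIV. f i x * \<eta> x) * \<eta> (1 / c) =
      (\<Sum>x\<in>M \<rightarrow>\<^sub>E UNIV. (\<Prod>i\<in>M. f i (x i)) * \<eta> ((\<Prod>i\<in>M. x i) / c))"
      by (simp add: sum_distrib_right prod.distrib mult.assoc)
  qed
  also have "\<dots> = (\<Sum>x\<in>M \<rightarrow>\<^sub>E UNIV. (\<Prod>i\<in>M. f i (x i)) * (\<Sum>\<eta>\<in>mult_chars. \<eta> ((\<Prod>i\<in>M. x i) / c)))"
    by (subst sum.swap) (simp add: sum_distrib_left)
  also have "\<dots> = (\<Sum>x\<in>M \<rightarrow>\<^sub>E UNIV. if (\<Prod>i\<in>M. x i) = c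
      then (of_nat CARD('a) - 1) * (\<Prod>i\<in>M. f i (x i)) else 0)"
    by (intro sum.cong refl) (use assms(2) in \<open>auto simp: sum_mult_chars\<close>)
  also have "\<dots> = (\<Sum>x\<in>torus_points M M c. (of_nat CARD('a) - 1) * (\<Prod>i\<in>M. f i (x i)))"
    using fin by (simp add: torus_points_def sum.inter_filter)
  finally show ?thesis by (simp add: sum_distrib_left)
qed

text \<open>In \<open>sum_torus_points\<close> with all \<open>f i\<close> equal to 1 only the
  trivial character survives: since \<open>M\<close> is nonempty, every other one contributes a
  vanishing factor.\<close>

lemma card_torus_points:
  fixes c :: "'a::{field,finite}"
  assumes "finite I" "M \<subseteq> I" "M \<noteq> {}" "c \<noteq> 0"
  shows "of_nat (card (torus_points I M c)) =
    ((of_nat CARD('a) - 1) ^ (card M - 1) * of_nat CARD('a) ^ card (I - M)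
      :: 'w::{alg_closed_field,field_char_0})"
proof -
  let ?q = "of_nat CARD('a) :: 'w"
  have finM: "finite M" using assms finite_subset by blast
  have q1: "?q - 1 \<noteq> 0" using finite_field_card_gt_1[where 'a = 'a] by simp
  have restr: "(\<Prod>i\<in>M. restrict x M i) = (\<Prod>i\<in>M. x i)" for x :: "nat \<Rightarrow> 'a"
    by (rule prod.cong) auto
  have IM: "M \<union> I = I" using assms(2) by auto
  have "(?q - 1) * (\<Sum>x\<in>torus_points M M c. \<Prod>i\<in>M. 1) =
      (\<Sum>\<eta>\<in>mult_chars. (\<Prod>i\<in>M. \<Sum>x\<in>UNIV. 1 * \<eta> x) * \<eta> (1 / c))"
    by (rule sum_torus_points[OF finM assms(4)])
  also have "\<dots> = (\<Sum>\<eta>\<in>{triv_char}. (\<Prod>i\<in>M. \<Sum>x\<in>UNIV. 1 * \<eta> x) * \<eta> (1 / c))"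
    by (rule sum.mono_neutral_right)
       (use finite_mult_chars triv_char_in finM assms(3) in \<open>auto simp: sum_nontrivial_mult_char card_gt_0_iff\<close>)
  also have "\<dots> = (?q - 1) ^ card M" using assms(4) by (simp add: sum_triv_char) (simp add: triv_char_def)
  also have "\<dots> = (?q - 1) * (?q - 1) ^ (card M - 1)"
    using finM assms(3) by (metis card_gt_0_iff power_eq_if not_gr_zero)
  finally have cM: "of_nat (card (torus_points M M c)) = (?q - 1) ^ (card M - 1)"
    using q1 by simp
  have "of_nat (card (torus_points I M c)) =
      (\<Sum>y\<in>torus_points M M c. \<Sum>u\<in>(I - M) \<rightarrow>\<^sub>E (UNIV :: 'a set). 1 :: 'w)"
    unfolding torus_points_def
    using sum_PiE_Un[where A = M and B = "I - M" and Q = "\<lambda>y. (\<Prod>i\<in>M. y i) = c"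
        and f = "\<lambda>_ _. 1 :: 'w"] finM assms(1)
    by (simp add: restr IM)
  also have "\<dots> = of_nat (card (torus_points M M c)) * ?q ^ card (I - M)"
    using assms(1) by (simp add: card_PiE)
  finally show ?thesis by (simp only: cM)
qed

section \<open>Counting the points of \<open>H\<close> by characters\<close>

definition H_rhs :: "nat \<Rightarrow> nat \<Rightarrow> nat \<Rightarrow> (nat \<Rightarrow> nat) \<Rightarrow> (nat \<Rightarrow> nat) \<Rightarrow> (nat \<Rightarrow> 'a::field) \<Rightarrow> 'a" where
  "H_rhs n m m1 v w x =
     (\<Prod>i = 1..m. x i ^ rep1 n (int (v i)))
     * (\<Prod>i = m1 + 1..m - 2. x (m + (i - m1)) ^ rep1 n (int (v i) - int (w i)))
     * (\<Prod>i = 1..m - 1. (1 - x i) ^ rep1 n (int (w i) - int (v i)))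
     * (1 - (\<Sum>i = m..2 * m - m1 - 2. x i)) ^ rep1 n (int (v (m - 1)) - int (w (m - 1)))"

text \<open>The summand 1 in \<open>card_nth_roots\<close> contributes the number of admissible
  \<open>x\<close>, which is exactly the subtracted term; the nontrivial powers of
  \<open>\<chi>\<close> remain.\<close>

lemma card_H_points:
  fixes \<psi> :: "'a::{field,finite}" and \<chi> :: "'a \<Rightarrow> 'w::{alg_closed_field,field_char_0}"
  assumes "\<chi> \<in> mult_chars" "char_has_order \<chi> n" "\<psi> \<noteq> 0" "m1 + 2 \<le> m"
  shows "of_int (int (card (H_points n m m1 v w \<psi>)) -
      (int CARD('a) - 1) ^ (m - 1) * int CARD('a) ^ (m - m1 - 2)) =
    (\<Sum>j = 1..<n. \<Sum>x\<in>torus_points {1..2 * m - m1 - 2} {1..m} (\<psi> ^ n).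
       char_pow \<chi> j (H_rhs n m m1 v w x))"
proof -
  let ?X = "torus_points {1..2 * m - m1 - 2} {1..m} (\<psi> ^ n)"
  have finX: "finite ?X" unfolding torus_points_def
    by (rule finite_subset[of _ "{1..2 * m - m1 - 2} \<rightarrow>\<^sub>E UNIV"]) (auto intro: finite_PiE)
  have "H_points n m m1 v w \<psi> = (SIGMA x:?X. {y. y ^ n = H_rhs n m m1 v w x})"
    by (auto simp: H_points_def torus_points_def H_rhs_def)
  hence "card (H_points n m m1 v w \<psi>) = (\<Sum>x\<in>?X. card {y. y ^ n = H_rhs n m m1 v w x})"
    using finX by simp
  hence "of_nat (card (H_points n m m1 v w \<psi>)) =
      (\<Sum>x\<in>?X. 1 + (\<Sum>j = 1..<n. char_pow \<chi> j (H_rhs n m m1 v w x)))"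
    by (simp add: card_nth_roots[OF assms(1,2)])
  also have "\<dots> = of_nat (card ?X) + (\<Sum>j = 1..<n. \<Sum>x\<in>?X. char_pow \<chi> j (H_rhs n m m1 v w x))"
    unfolding sum.distrib by (subst sum.swap) simp
  also have "of_nat (card ?X) =
      ((of_nat CARD('a) - 1) ^ (m - 1) * of_nat CARD('a) ^ (m - m1 - 2) :: 'w)"
  proof -
    have "card ({1..2 * m - m1 - 2} - {1..m}) = m - m1 - 2"
      using assms(4) by (subst card_Diff_subset) auto
    moreover have "{1..m} \<subseteq> {1..2 * m - m1 - 2}" "{1..m} \<noteq> {}" using assms(4) by auto
    ultimately show ?thesis
      using card_torus_points[of "{1..2 * m - m1 - 2}" "{1..m}" "\<psi> ^ n", where 'w = 'w] assms(3)
      by simp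
  qed
  finally show ?thesis by simp
qed

section \<open>The tuple sum as a character sum over the coordinates of \<open>H\<close>\<close>

context character_data
begin

lemma char_pow_eq_power: "k \<ge> 1 \<Longrightarrow> char_pow \<chi> k x = \<chi> x ^ k"
  using mult_chars_0[OF \<chi>(1)] by (auto simp: char_pow_def)

lemma prod_G_pairs: "l \<le> m1 div 2 \<Longrightarrow> (\<Prod>i = 1..2 * l. G (d i)) = q ^ l"
proof (induction l)
  case (Suc l)
  have "(\<Prod>i = 1..2 * Suc l. G (d i)) = (\<Prod>i = 1..2 * l. G (d i)) * (G (d (2 * Suc l - 1)) * G (d (2 * Suc l)))"
    by simp
  also have "G (d (2 * Suc l - 1)) * G (d (2 * Suc l)) = q"
    by (intro G_mult d_pair not_dvd_d) (use Suc.prems m1_le in auto)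
  also have "(\<Prod>i = 1..2 * l. G (d i)) = q ^ l" using Suc by simp
  finally show ?case by (simp only: power_Suc2)
qed simp

definition point_sum :: "'a \<Rightarrow> 'w" where
  "point_sum c = (\<Sum>x\<in>torus_points {1..2 * m - m1 - 2} {1..m} c. \<chi> (H_rhs n m m1 v w x))"

definition torus_sum :: "'a \<Rightarrow> 'w" where
  "torus_sum c = (\<Sum>x\<in>torus_points {1..m} {1..m} c.
     \<Prod>i = 1..m. char_pow \<chi> (v i) (x i) * char_pow \<chi> (d i) (1 - x i))"

lemma sum_prod_J:
  assumes "c \<noteq> 0"
  shows "(\<Sum>\<eta>\<in>mult_chars. (\<Prod>i = 1..m. J \<eta> i) * \<eta> (1 / c)) = (q - 1) * torus_sum c"
  using sum_torus_points[of "{1..m}" c "\<lambda>i x. char_pow \<chi> (v i) x * char_pow \<chi> (d i) (1 - x)"] assms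
  by (simp add: torus_sum_def J_def q_def char_mult_def mult_ac)

text \<open>The characters with exponents \<open>e i\<close> for \<open>m1 < i < m\<close> have the
  nontrivial product \<open>char_pow \<chi> (d m)\<close> by \<open>sum_e\<close>, so
  \<open>jacobi_conv_gauss_sum\<close> applies. The sum runs over the coordinates of
  \<open>H\<close> beyond the \<open>m\<close>-th.\<close>

lemma jacobi_conv_fibre:
  defines "E \<equiv> \<lambda>k. char_pow \<chi> (e (k - m + m1))"
  shows "G (d m) * jacobi_conv {m + 1..2 * m - m1 - 2} E (char_pow \<chi> (e (m - 1))) t =
    char_pow \<chi> (d m) t * (\<Prod>i = m1 + 1..m - 1. G (e i))"
proof -
  let ?K = "{m + 1..2 * m - m1 - 2}"
  \<comment> \<open>Coordinate \<open>k\<close> carries the exponent with index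
    \<open>k - m + m1\<close>, running from \<open>m1 + 1\<close> to \<open>m - 2\<close>; the index
    \<open>m - 1\<close> belongs to the eliminated argument.\<close>
  have shift: "(\<Prod>k\<in>?K. f (k - m + m1)) * f (m - 1) = (\<Prod>i = m1 + 1..m - 1. f i)"
    for f :: "nat \<Rightarrow> 'w"
  proof -
    have "(\<Prod>k\<in>?K. f (k - m + m1)) = (\<Prod>i = m1 + 1..m - 2. f i)"
      by (rule prod.reindex_bij_witness[where j = "\<lambda>k. k - m + m1" and i = "\<lambda>i. i - m1 + m"])
         (use m1_le in auto)
    moreover have "{m1 + 1..m - 1} = insert (m - 1) {m1 + 1..m - 2}" using m1_le by auto
    hence "(\<Prod>i = m1 + 1..m - 1. f i) = f (m - 1) * (\<Prod>i = m1 + 1..m - 2. f i)"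
      using m1_le by (simp only:) (rule prod.insert; auto)
    ultimately show ?thesis by (simp only: mult.commute)
  qed
  have C: "char_pow \<chi> (d m) x = char_pow \<chi> (e (m - 1)) x * (\<Prod>k\<in>?K. E k x)" for x
  proof (cases "x = 0")
    case False
    have "char_pow \<chi> (e (m - 1)) x * (\<Prod>k\<in>?K. E k x) = (\<Prod>i = m1 + 1..m - 1. \<chi> x ^ e i)"
      using shift[of "\<lambda>i. \<chi> x ^ e i"] False by (simp add: E_def char_pow_def mult.commute)
    also have "\<dots> = \<chi> x ^ d m"
      unfolding power_sum[symmetric] by (rule char_power_cong[OF \<chi>(2) sum_e False])
    finally show ?thesis using False by (simp add: char_pow_def)
  qed (simp add: char_pow_def)
  have "G (d m) * jacobi_conv ?K E (char_pow \<chi> (e (m - 1))) t =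
      char_pow \<chi> (d m) t * ((\<Prod>k\<in>?K. gauss_sum \<phi> (E k)) * gauss_sum \<phi> (char_pow \<chi> (e (m - 1))))"
    unfolding G_def
    by (rule jacobi_conv_gauss_sum[OF _ _ _ \<phi> C])
       (use m1_le in \<open>auto simp: E_def intro!: char_pow_in \<chi> char_pow_nontrivial not_dvd_d\<close>)
  also have "(\<Prod>k\<in>?K. gauss_sum \<phi> (E k)) * gauss_sum \<phi> (char_pow \<chi> (e (m - 1))) =
      (\<Prod>i = m1 + 1..m - 1. G (e i))"
    using shift[of "\<lambda>i. G (e i)"] by (simp add: E_def G_def)
  finally show ?thesis .
qed

text \<open>All exponents are at least 1, so \<open>\<chi> (y ^ k)\<close> equals
  \<open>char_pow \<chi> k y\<close> even at \<open>y = 0\<close>. The coordinate \<open>x m\<close>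
  is split off the last sum to expose a convolution at \<open>1 - x m\<close>.\<close>

lemma chi_H_rhs:
  fixes x :: "nat \<Rightarrow> 'a"
  shows "\<chi> (H_rhs n m m1 v w x) =
    (\<Prod>i = 1..m. char_pow \<chi> (v i) (x i)) * (\<Prod>i = 1..m - 1. char_pow \<chi> (d i) (1 - x i)) *
    ((\<Prod>k = m + 1..2 * m - m1 - 2. char_pow \<chi> (e (k - m + m1)) (x k)) *
     char_pow \<chi> (e (m - 1)) ((1 - x m) - (\<Sum>k = m + 1..2 * m - m1 - 2. x k)))"
proof -
  have v': "char_pow \<chi> (v i) y = \<chi> y ^ rep1 n (int (v i))" for i y
  proof -
    have "[v i = rep1 n (int (v i))] (mod n)"
      using rep1_cong[OF n_pos, of "int (v i)"] by (simp add: cong_int_iff cong_sym_eq)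
    hence "char_pow \<chi> (v i) = char_pow \<chi> (rep1 n (int (v i)))"
      by (rule char_pow_cong[OF \<chi>(2)])
    thus ?thesis by (simp only: char_pow_eq_power[OF rep1_ge_1[OF n_pos]])
  qed
  have d': "char_pow \<chi> (d i) y = \<chi> y ^ d i" for i y
    unfolding d_def by (rule char_pow_eq_power[OF rep1_ge_1[OF n_pos]])
  have e': "char_pow \<chi> (e i) y = \<chi> y ^ e i" for i y
    unfolding e_def by (rule char_pow_eq_power[OF rep1_ge_1[OF n_pos]])
  have "{m..2 * m - m1 - 2} = insert m {m + 1..2 * m - m1 - 2}" using m1_le by auto
  hence sum: "1 - (\<Sum>i = m..2 * m - m1 - 2. x i) = (1 - x m) - (\<Sum>k = m + 1..2 * m - m1 - 2. x k)"
    by simp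
  have shift: "(\<Prod>i = m1 + 1..m - 2. x (m + (i - m1)) ^ e i) =
      (\<Prod>k = m + 1..2 * m - m1 - 2. x k ^ e (k - m + m1))"
    by (rule prod.reindex_bij_witness[where i = "\<lambda>k. k - m + m1" and j = "\<lambda>i. m + (i - m1)"])
       (use m1_le in auto)
  show ?thesis
    unfolding H_rhs_def sum d_def[symmetric] e_def[symmetric] shift
      mult_chars_mult[OF \<chi>(1)] mult_chars_prod[OF \<chi>(1)] mult_chars_power[OF \<chi>(1)] v' d' e'
    by (simp only: mult_ac)
qed

text \<open>The factor \<open>char_pow \<chi> (d m) (1 - x m)\<close> of \<open>torus_sum\<close> is
  replaced by the convolution in \<open>jacobi_conv_fibre\<close>, whose variables become the
  additional coordinates.\<close>

lemma torus_sum_point_sum: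
  "torus_sum c * (\<Prod>i = m1 + 1..m - 1. G (e i)) = G (d m) * point_sum c"
proof -
  let ?K = "{m + 1..2 * m - m1 - 2}" and ?E = "\<lambda>k. char_pow \<chi> (e (k - m + m1))"
  \<comment> \<open>\<open>F\<close> collects the factors common to both sums, and
    \<open>T y u\<close> is the summand of the convolution, with \<open>y\<close> the torus part and
    \<open>u\<close> the additional coordinates.\<close>
  define F where "F y = (\<Prod>i = 1..m. char_pow \<chi> (v i) (y i)) *
    (\<Prod>i = 1..m - 1. char_pow \<chi> (d i) (1 - y i))" for y :: "nat \<Rightarrow> 'a"
  define T where "T y u = (\<Prod>k\<in>?K. ?E k (u k)) *
    char_pow \<chi> (e (m - 1)) ((1 - y m) - (\<Sum>k\<in>?K. u k))" for y u :: "nat \<Rightarrow> 'a"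
  have "{1..m} = insert m {1..m - 1}" using m1_le by auto
  hence split: "(\<Prod>i = 1..m. char_pow \<chi> (v i) (x i) * char_pow \<chi> (d i) (1 - x i)) =
      F x * char_pow \<chi> (d m) (1 - x m)" for x :: "nat \<Rightarrow> 'a"
    using m1_le unfolding F_def prod.distrib by simp
  have conv: "jacobi_conv ?K ?E (char_pow \<chi> (e (m - 1))) (1 - y m) = (\<Sum>u\<in>?K \<rightarrow>\<^sub>E UNIV. T y u)"
    for y :: "nat \<Rightarrow> 'a"
    by (simp add: jacobi_conv_def T_def)
  have "torus_sum c * (\<Prod>i = m1 + 1..m - 1. G (e i)) =
      (\<Sum>y\<in>torus_points {1..m} {1..m} c. F y * (char_pow \<chi> (d m) (1 - y m) * (\<Prod>i = m1 + 1..m - 1. G (e i))))"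
    unfolding torus_sum_def split sum_distrib_right by (simp only: mult.assoc)
  also have "\<dots> = G (d m) * (\<Sum>y\<in>torus_points {1..m} {1..m} c. \<Sum>u\<in>?K \<rightarrow>\<^sub>E UNIV. F y * T y u)"
    unfolding jacobi_conv_fibre[symmetric] conv sum_distrib_left
    by (intro sum.cong refl) (simp only: mult_ac)
  also have "(\<Sum>y\<in>torus_points {1..m} {1..m} c. \<Sum>u\<in>?K \<rightarrow>\<^sub>E UNIV. F y * T y u) = point_sum c"
  proof -
    have Un: "{1..m} \<union> ?K = {1..2 * m - m1 - 2}" using m1_le by auto
    have F: "F (restrict x {1..m}) = F x" for x
      unfolding F_def by (intro arg_cong2[where f = "(*)"] prod.cong) auto
    have "(\<Prod>k\<in>?K. ?E k (restrict x ?K k)) = (\<Prod>k\<in>?K. ?E k (x k))"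
      "(\<Sum>k\<in>?K. restrict x ?K k) = (\<Sum>k\<in>?K. x k)" for x :: "nat \<Rightarrow> 'a"
      by (intro prod.cong sum.cong; simp)+
    moreover have "restrict x {1..m} m = x m" for x :: "nat \<Rightarrow> 'a" using m1_le by simp
    ultimately have T: "T (restrict x {1..m}) (restrict x ?K) = T x x" for x
      unfolding T_def by (simp only:)
    have P: "(\<Prod>i = 1..m. restrict x {1..m} i) = (\<Prod>i = 1..m. x i)" for x :: "nat \<Rightarrow> 'a"
      by (rule prod.cong) auto
    have "(\<Sum>y\<in>{y \<in> {1..m} \<rightarrow>\<^sub>E UNIV. (\<Prod>i = 1..m. y i) = c}. \<Sum>u\<in>?K \<rightarrow>\<^sub>E UNIV. F y * T y u) =
      (\<Sum>x\<in>{x \<in> {1..m} \<union> ?K \<rightarrow>\<^sub>E UNIV. (\<Prod>i = 1..m. restrict x {1..m} i) = c}.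
         F (restrict x {1..m}) * T (restrict x {1..m}) (restrict x ?K))"
      by (rule sum_PiE_Un) auto
    thus ?thesis
      unfolding point_sum_def torus_points_def chi_H_rhs F T P Un by (simp only: F_def T_def)
  qed
  finally show ?thesis .
qed

text \<open>With \<open>m1 = 2 * l\<close>, the pairs contribute \<open>q ^ l\<close> and the
  products \<open>G (d i) * G (e i)\<close> for \<open>m1 < i < m\<close> contribute
  \<open>q ^ (m - 1 - m1)\<close>, together \<open>q ^ (m - 1 - l)\<close>. The factor
  \<open>G (d m)\<close> cancels against \<open>torus_sum_point_sum\<close>.\<close>

lemma N_tuple_eq:
  assumes "\<psi> \<noteq> 0"
  shows "N_tuple n \<phi> \<chi> \<psi> s =
    q powi (int ((n + 1) div 2) - int ((2 * m - m1) div 2)) * point_sum (\<psi> ^ n)"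
proof -
  let ?c = "\<psi> ^ n" and ?r = "(n - 1) div 2" and ?Q = "\<Prod>i = 1..m. G (d i)"
  obtain l where l: "m1 = 2 * l" using even_m1 by (elim evenE)
  have "(\<Sum>\<eta>\<in>mult_chars. beta n \<phi> \<chi> s \<eta> * \<eta> (1 / ?c)) =
      (\<Sum>\<eta>\<in>mult_chars. q ^ ?r / ?Q * ((\<Prod>i = 1..m. J \<eta> i) * \<eta> (1 / ?c)))"
    by (rule sum.cong) (simp_all add: beta_eq prod_dividef)
  hence "N_tuple n \<phi> \<chi> \<psi> s = 1 / (q - 1) * (\<Sum>\<eta>\<in>mult_chars. q ^ ?r / ?Q * ((\<Prod>i = 1..m. J \<eta> i) * \<eta> (1 / ?c)))"
    unfolding N_tuple_def q_def by (simp only:)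
  also have "\<dots> = q ^ ?r / ?Q * torus_sum ?c"
  proof -
    have "?c \<noteq> 0" using assms by simp
    thus ?thesis
      unfolding sum_distrib_left[symmetric] sum_prod_J[OF \<open>?c \<noteq> 0\<close>] using q_minus_1_nonzero by simp
  qed
  also have "\<dots> = q ^ ?r / q ^ (m - 1 - l) * point_sum ?c"
  proof -
    let ?D = "\<Prod>i = m1 + 1..m - 1. G (d i)" and ?E = "\<Prod>i = m1 + 1..m - 1. G (e i)"
    have "{1..m} = {1..m1} \<union> {m1 + 1..m - 1} \<union> {m}" using m1_le by auto
    hence "?Q = (\<Prod>i = 1..m1. G (d i)) * ?D * G (d m)"
      using m1_le by (simp add: prod.union_disjoint)
    hence Q: "?Q = q ^ l * ?D * G (d m)" using prod_G_pairs[of l] l by simp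
    have "?D * ?E = (\<Prod>i = m1 + 1..m - 1. q)"
      unfolding prod.distrib[symmetric]
      by (intro prod.cong refl G_mult d_plus_e not_dvd_e) auto
    also have "\<dots> = q ^ (m - 1 - m1)" by simp
    finally have DE: "?D * ?E = q ^ (m - 1 - m1)" .
    have "?Q * ?E = q ^ l * (?D * ?E) * G (d m)" unfolding Q by (simp only: mult_ac)
    also have "\<dots> = q ^ (m - 1 - l) * G (d m)"
      unfolding DE power_add[symmetric] using m1_le l by simp
    finally have QE: "?Q * ?E = q ^ (m - 1 - l) * G (d m)" .
    have E0: "?E \<noteq> 0" using G_nonzero by simp
    have Q0: "?Q \<noteq> 0" using G_nonzero by simp
    \<comment> \<open>Both sides are multiplied by the nonzero \<open>?E * G (d m)\<close>, so that
      \<open>torus_sum_point_sum\<close> and \<open>QE\<close> can be substituted without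
      division.\<close>
    have "(torus_sum ?c * q ^ (m - 1 - l)) * (?E * G (d m)) = (torus_sum ?c * ?E) * (q ^ (m - 1 - l) * G (d m))"
      by (simp add: mult_ac)
    also have "\<dots> = (point_sum ?c * ?Q) * (?E * G (d m))"
      unfolding torus_sum_point_sum QE[symmetric] by (simp only: mult_ac)
    finally have "torus_sum ?c * q ^ (m - 1 - l) = point_sum ?c * ?Q"
      using E0 G_nonzero by simp
    thus ?thesis using Q0 q_nonzero by (simp add: field_simps)
  qed
  also have "q ^ ?r / q ^ (m - 1 - l) = q powi (int ((n + 1) div 2) - int ((2 * m - m1) div 2))"
  proof -
    have "int ((n + 1) div 2) = int ?r + 1" using odd_n by (auto elim!: oddE)
    moreover have "(2 * m - m1) div 2 = m - l" using l by (simp add: diff_mult_distrib2[symmetric])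
    moreover have "int (m - l) = int (m - 1 - l) + 1" using m1_le l by simp
    ultimately have "int ((n + 1) div 2) - int ((2 * m - m1) div 2) = int ?r - int (m - 1 - l)" by simp
    thus ?thesis using q_nonzero by (simp add: power_int_diff)
  qed
  finally show ?thesis .
qed

end

section \<open>Orbits of affine maps\<close>

text \<open>Translations and scalings are both of this form, which is closed under
  composition.\<close>

definition affine :: "nat \<Rightarrow> nat \<Rightarrow> nat \<Rightarrow> nat list \<Rightarrow> nat list" where
  "affine n k j t = map (\<lambda>x. (k * x + j) mod n) t"

lemma translate_eq_affine: "translate n j t = affine n 1 j t"
  by (simp add: translate_def affine_def)

lemma scale_eq_affine: "scale n k t = affine n k 0 t"
  by (simp add: scale_def affine_def)

lemma affine_affine: "affine n k' j' (affine n k j t) = affine n (k' * k) (k' * j + j') t"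
proof -
  have "(k' * ((k * x + j) mod n) + j') mod n = (k' * k * x + (k' * j + j')) mod n" for x
  proof -
    have "(k' * ((k * x + j) mod n) + j') mod n = (k' * (k * x + j) + j') mod n"
      by (metis mod_add_left_eq mod_mult_right_eq)
    thus ?thesis by (simp add: algebra_simps)
  qed
  thus ?thesis by (simp add: affine_def)
qed

lemma affine_cong:
  assumes "[k = k'] (mod n)" "[j = j'] (mod n)"
  shows "affine n k j t = affine n k' j' t"
proof -
  have "[k * x + j = k' * x + j'] (mod n)" for x
    by (intro cong_add cong_mult assms cong_refl)
  thus ?thesis by (simp add: affine_def cong_def)
qed

lemma affine_1_0: "t \<in> tuples n \<Longrightarrow> affine n 1 0 t = t"
  by (auto simp: affine_def tuples_def intro!: map_idI)

lemma affine_in: "n > 0 \<Longrightarrow> t \<in> tuples n \<Longrightarrow> affine n k j t \<in> tuples n"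
  by (auto simp: affine_def tuples_def)

lemma mset_affine: "mset (affine n k j t) = image_mset (\<lambda>x. (k * x + j) mod n) (mset t)"
  by (simp add: affine_def)

text \<open>Lists are permutations of each other exactly when their multisets agree, which removes
  \<open>\<sigma>\<close> from all later arguments.\<close>

lemma mem_trans_perm_orbit_iff:
  assumes "length t = n"
  shows "x \<in> trans_perm_orbit n t \<longleftrightarrow> (\<exists>j<n. mset x = mset (affine n 1 j t))"
proof
  assume "x \<in> trans_perm_orbit n t"
  thus "\<exists>j<n. mset x = mset (affine n 1 j t)"
    using assms by (auto simp: trans_perm_orbit_def translate_eq_affine affine_def)
next
  assume "\<exists>j<n. mset x = mset (affine n 1 j t)"
  then obtain j where j: "j < n" "mset x = mset (affine n 1 j t)" by auto
  then obtain \<sigma> where "\<sigma> permutes {..<length (affine n 1 j t)}" "permute_list \<sigma> (affine n 1 j t) = x"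
    by (elim mset_eq_permutation)
  thus "x \<in> trans_perm_orbit n t"
    using assms j(1) by (auto simp: trans_perm_orbit_def translate_eq_affine affine_def)
qed

lemma trans_perm_orbit_eqI:
  assumes "t \<in> tuples n" "t' \<in> trans_perm_orbit n t"
  shows "trans_perm_orbit n t' = trans_perm_orbit n t"
proof -
  have len: "length t = n" using assms(1) by (simp add: tuples_def)
  obtain i where i: "i < n" "mset t' = mset (affine n 1 i t)"
    using assms(2) mem_trans_perm_orbit_iff[OF len] by auto
  have len': "length t' = n" using i(2) len by (metis affine_def length_map size_mset)
  have eq: "mset (affine n 1 j t') = mset (affine n 1 (i + j) t)" for j
    using affine_affine[of n 1 j 1 i t] i(2) by (metis mset_affine mult_1)
  have "(\<exists>j<n. mset x = mset (affine n 1 j t')) \<longleftrightarrow> (\<exists>j<n. mset x = mset (affine n 1 j t))" for x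
  proof
    assume "\<exists>j<n. mset x = mset (affine n 1 j t')"
    then obtain j where "j < n" "mset x = mset (affine n 1 (i + j) t)" using eq by auto
    moreover have "affine n 1 (i + j) t = affine n 1 ((i + j) mod n) t"
      by (rule affine_cong) (auto simp: cong_def)
    ultimately show "\<exists>j<n. mset x = mset (affine n 1 j t)" using i(1) by (metis mod_less_divisor not_gr_zero not_less_zero)
  next
    assume "\<exists>j<n. mset x = mset (affine n 1 j t)"
    then obtain j where j: "j < n" "mset x = mset (affine n 1 j t)" by auto
    \<comment> \<open>As \<open>i < n\<close>, the truncated difference \<open>n - i\<close>
      represents the inverse translation.\<close>
    have "affine n 1 (i + (j + (n - i)) mod n) t = affine n 1 j t"
      by (rule affine_cong) (use i(1) in \<open>auto simp: cong_def mod_simps\<close>)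
    hence "mset x = mset (affine n 1 ((j + (n - i)) mod n) t')" using j eq by simp
    thus "\<exists>j<n. mset x = mset (affine n 1 j t')" using j(1) by (metis mod_less_divisor not_gr_zero not_less_zero)
  qed
  thus ?thesis by (auto simp: mem_trans_perm_orbit_iff[OF len] mem_trans_perm_orbit_iff[OF len'])
qed

lemma mem_trans_perm_orbit_self:
  assumes "t \<in> tuples n" "n > 0"
  shows "t \<in> trans_perm_orbit n t"
proof -
  have "length t = n" using assms(1) by (simp add: tuples_def)
  thus ?thesis using assms affine_1_0[OF assms(1)] by (auto simp: mem_trans_perm_orbit_iff intro!: exI[of _ 0])
qed

text \<open>Scaling turns a translation by \<open>i\<close> into one by \<open>k * i\<close>, so the
  units act on classes.\<close>

lemma trans_perm_orbit_scale_mono: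
  assumes "t \<in> tuples n" "n > 0" "t' \<in> trans_perm_orbit n t"
  shows "affine n k 0 t' \<in> trans_perm_orbit n (affine n k 0 t)"
proof -
  have len: "length t = n" using assms(1) by (simp add: tuples_def)
  obtain i where i: "mset t' = mset (affine n 1 i t)"
    using assms(3) mem_trans_perm_orbit_iff[OF len] by auto
  have "mset (affine n k 0 t') = mset (affine n k 0 (affine n 1 i t))" using i by (metis mset_affine)
  also have "affine n k 0 (affine n 1 i t) = affine n 1 ((k * i) mod n) (affine n k 0 t)"
    unfolding affine_affine by (rule affine_cong) (auto simp: cong_def)
  finally have "\<exists>j<n. mset (affine n k 0 t') = mset (affine n 1 j (affine n k 0 t))"
    using assms(2) by (intro exI[of _ "(k * i) mod n"]) simp
  moreover have "length (affine n k 0 t) = n" using len by (simp add: affine_def)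
  ultimately show ?thesis by (simp only: mem_trans_perm_orbit_iff)
qed

lemma units_mod_mult:
  assumes "n > 1" "k \<in> units_mod n" "k' \<in> units_mod n"
  shows "(k * k') mod n \<in> units_mod n"
  using assms by (simp add: units_mod_def coprime_mod_left_iff)

lemma inj_on_mult_units_mod:
  assumes "k \<in> units_mod n"
  shows "inj_on (\<lambda>k'. (k * k') mod n) (units_mod n)"
proof (rule inj_onI)
  fix a b assume "a \<in> units_mod n" "b \<in> units_mod n" "(k * a) mod n = (k * b) mod n"
  hence "[a = b] (mod n)" "a < n" "b < n"
    using assms by (auto simp: units_mod_def cong_def[symmetric] cong_mult_lcancel_nat)
  thus "a = b" by (simp add: cong_less_modulus_unique_nat)
qed

lemma units_mod_inverse:
  assumes "n > 1" "k \<in> units_mod n"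
  obtains u where "u \<in> units_mod n" "[k * u = 1] (mod n)"
proof -
  have "coprime k n" using assms by (simp add: units_mod_def)
  then obtain x where x: "[k * x = 1] (mod n)" using cong_solve_coprime_nat[of k n] by auto
  hence "[k * (x mod n) = 1] (mod n)" by (simp add: cong_def mod_simps)
  moreover from this have "coprime (x mod n) n"
    by (metis coprime_commute coprime_mult_right_iff cong_imp_coprime cong_sym coprime_1_left coprime_mult_left_iff)
  ultimately show ?thesis using that[of "x mod n"] assms(1) by (simp add: units_mod_def)
qed

text \<open>This identifies \<open>K_num n s\<close> as the order of the stabilizer of the class of
  \<open>s\<close> under scaling.\<close>

lemma K_num_eq:
  assumes "s \<in> tuples n" "n > 0"
  shows "K_num n s = card {k \<in> units_mod n. trans_perm_orbit n (affine n k 0 s) = trans_perm_orbit n s}"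
proof -
  have len: "length s = n" using assms(1) by (simp add: tuples_def)
  have "(\<exists>\<sigma>. \<sigma> permutes {..<n} \<and> trans_orbit n (scale n k s) = trans_orbit n (permute_list \<sigma> s)) \<longleftrightarrow>
    trans_perm_orbit n (affine n k 0 s) = trans_perm_orbit n s" (is "?L \<longleftrightarrow> ?R") for k
  proof
    assume ?L
    then obtain \<sigma> where \<sigma>: "\<sigma> permutes {..<n}" "trans_orbit n (scale n k s) = trans_orbit n (permute_list \<sigma> s)"
      by auto
    have "scale n k s \<in> trans_orbit n (scale n k s)"
      using affine_1_0[OF affine_in[OF assms(2,1), of k 0]] assms(2)
      by (auto simp: trans_orbit_def translate_eq_affine scale_eq_affine intro!: exI[of _ 0])
    then obtain j where "j < n" "scale n k s = affine n 1 j (permute_list \<sigma> s)"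
      unfolding \<sigma>(2) by (auto simp: trans_orbit_def translate_eq_affine)
    hence "affine n k 0 s \<in> trans_perm_orbit n s"
      using \<sigma>(1) len by (auto simp: mem_trans_perm_orbit_iff scale_eq_affine mset_affine)
    thus ?R by (rule trans_perm_orbit_eqI[OF assms(1)])
  next
    assume ?R
    hence "affine n k 0 s \<in> trans_perm_orbit n s"
      using mem_trans_perm_orbit_self[OF affine_in[OF assms(2,1), of k 0] assms(2)] by simp
    then obtain \<sigma> j where \<sigma>: "\<sigma> permutes {..<n}" "j < n" "affine n k 0 s = permute_list \<sigma> (translate n j s)"
      by (auto simp: trans_perm_orbit_def)
    have eq: "affine n k 0 s = affine n 1 j (permute_list \<sigma> s)"
      unfolding \<sigma>(3) translate_eq_affine using \<sigma>(1) len by (simp add: affine_def permute_list_map)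
    have "trans_orbit n (affine n 1 j u) = trans_orbit n u" for u
    proof (intro equalityI subsetI)
      fix x assume "x \<in> trans_orbit n (affine n 1 j u)"
      then obtain i where "x = affine n 1 i (affine n 1 j u)"
        by (auto simp: trans_orbit_def translate_eq_affine)
      hence "x = affine n 1 ((j + i) mod n) u"
        unfolding affine_affine by (simp add: affine_def mod_simps)
      thus "x \<in> trans_orbit n u" using assms(2)
        by (auto simp: trans_orbit_def translate_eq_affine intro!: exI[of _ "(j + i) mod n"])
    next
      fix x assume "x \<in> trans_orbit n u"
      then obtain i where i: "x = affine n 1 i u"
        by (auto simp: trans_orbit_def translate_eq_affine)
      have "affine n 1 ((i + (n - j)) mod n) (affine n 1 j u) = affine n 1 i u"
        unfolding affine_affine by (rule affine_cong) (use \<sigma>(2) in \<open>auto simp: cong_def mod_simps\<close>)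
      thus "x \<in> trans_orbit n (affine n 1 j u)" using assms(2) i
        by (auto simp: trans_orbit_def translate_eq_affine intro!: exI[of _ "(i + (n - j)) mod n"])
    qed
    thus ?L using eq \<sigma>(1) by (auto simp: scale_eq_affine)
  qed
  thus ?thesis unfolding K_num_def by simp
qed

text \<open>The fibres are cosets of the stabilizer. Multiplication by a unit embeds one fibre into
  another; using \<open>k0\<close> and its inverse \<open>u\<close> bounds the sizes both
  ways.\<close>

lemma card_scale_fibre:
  assumes "s \<in> tuples n" "n > 1" "k0 \<in> units_mod n"
  shows "card {k \<in> units_mod n. trans_perm_orbit n (affine n k 0 s) = trans_perm_orbit n (affine n k0 0 s)}
    = K_num n s"
proof -
  let ?F = "\<lambda>k0. {k \<in> units_mod n. trans_perm_orbit n (affine n k 0 s) = trans_perm_orbit n (affine n k0 0 s)}"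
  have n0: "n > 0" using assms(2) by simp
  have fin: "finite (?F a)" for a by (auto simp: units_mod_def)
  have le: "card (?F a) \<le> card (?F ((b * a) mod n))" if b: "b \<in> units_mod n" for a b
  proof (rule card_inj_on_le[OF _ _ fin])
    show "inj_on (\<lambda>k. (b * k) mod n) (?F a)"
      by (rule inj_on_subset[OF inj_on_mult_units_mod[OF b]]) auto
    show "(\<lambda>k. (b * k) mod n) ` ?F a \<subseteq> ?F ((b * a) mod n)"
    proof (rule image_subsetI)
      fix k assume "k \<in> ?F a"
      hence k: "k \<in> units_mod n"
        "trans_perm_orbit n (affine n k 0 s) = trans_perm_orbit n (affine n a 0 s)" by auto
      have bk: "(b * k) mod n \<in> units_mod n" by (rule units_mod_mult[OF assms(2) b k(1)])
      have mult: "affine n ((b * c) mod n) 0 s = affine n b 0 (affine n c 0 s)" for c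
        unfolding affine_affine by (rule affine_cong) (auto simp: cong_def)
      have "affine n k 0 s \<in> trans_perm_orbit n (affine n a 0 s)"
        unfolding k(2)[symmetric] by (intro mem_trans_perm_orbit_self affine_in n0 assms(1))
      hence "affine n b 0 (affine n k 0 s) \<in> trans_perm_orbit n (affine n b 0 (affine n a 0 s))"
        by (intro trans_perm_orbit_scale_mono affine_in n0 assms(1))
      hence "trans_perm_orbit n (affine n ((b * k) mod n) 0 s) = trans_perm_orbit n (affine n ((b * a) mod n) 0 s)"
        unfolding mult by (intro trans_perm_orbit_eqI affine_in n0 assms(1))
      thus "(b * k) mod n \<in> ?F ((b * a) mod n)" using bk by simp
    qed
  qed
  obtain u where u: "u \<in> units_mod n" "[k0 * u = 1] (mod n)"
    using units_mod_inverse[OF assms(2,3)] .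
  have "k0 < n" using assms(3) by (simp add: units_mod_def)
  hence "card (?F 1) \<le> card (?F k0)" using le[OF assms(3), of 1] by simp
  moreover have "(u * k0) mod n = 1" using u(2) assms(2) by (simp add: cong_def mult.commute)
  hence "card (?F k0) \<le> card (?F 1)" using le[OF u(1), of k0] by simp
  moreover have "card (?F 1) = K_num n s"
    using K_num_eq[OF assms(1) n0] affine_1_0[OF assms(1)] by simp
  ultimately show ?thesis by simp
qed

text \<open>A class absorbs translations and permutations, so only the scaling matters.\<close>

lemma trans_perm_orbit_image_full_orbit:
  assumes "s \<in> tuples n" "n > 0"
  shows "trans_perm_orbit n ` full_orbit n s = (\<lambda>k. trans_perm_orbit n (affine n k 0 s)) ` units_mod n"
proof -
  have tp: "trans_perm_orbit n x = trans_perm_orbit n (affine n k 0 s)"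
    if "\<sigma> permutes {..<n}" "j < n" "x = permute_list \<sigma> (translate n j (scale n k s))" for x \<sigma> j k
    using that by (intro trans_perm_orbit_eqI affine_in assms)
      (auto simp: trans_perm_orbit_def scale_eq_affine)
  show ?thesis
  proof (intro equalityI subsetI)
    fix C assume "C \<in> trans_perm_orbit n ` full_orbit n s"
    thus "C \<in> (\<lambda>k. trans_perm_orbit n (affine n k 0 s)) ` units_mod n"
      using tp by (fastforce simp: full_orbit_def)
  next
    fix C assume "C \<in> (\<lambda>k. trans_perm_orbit n (affine n k 0 s)) ` units_mod n"
    then obtain k where k: "k \<in> units_mod n" "C = trans_perm_orbit n (affine n k 0 s)" by auto
    let ?x = "permute_list id (translate n 0 (scale n k s))"
    have "?x \<in> full_orbit n s"
      unfolding full_orbit_def using k(1) assms(2) permutes_id by blast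
    moreover have "trans_perm_orbit n ?x = C" using tp[of id 0 ?x k] k(2) assms(2) permutes_id by simp
    ultimately show "C \<in> trans_perm_orbit n ` full_orbit n s" by blast
  qed
qed

lemma K_num_pos:
  assumes "s \<in> tuples n" "n > 1"
  shows "K_num n s > 0"
proof -
  have "finite {k \<in> units_mod n. trans_perm_orbit n (affine n k 0 s) = trans_perm_orbit n s}"
    by (auto simp: units_mod_def)
  moreover have "1 \<in> {k \<in> units_mod n. trans_perm_orbit n (affine n k 0 s) = trans_perm_orbit n s}"
    using assms affine_1_0[OF assms(1)] by (auto simp: units_mod_def)
  ultimately show ?thesis using K_num_eq[OF assms(1)] assms(2) by (auto simp: card_gt_0_iff)
qed

text \<open>Each class is reached by exactly \<open>K_num n s\<close> units, so summing over units
  instead of classes multiplies the sum by that number.\<close>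

lemma N_full_eq:
  fixes \<chi> :: "'a::{field,finite} \<Rightarrow> 'w::field_char_0"
  assumes "\<chi> \<in> mult_chars" "char_has_order \<chi> n" "s \<in> tuples n" "n > 1" "\<psi> \<noteq> 0"
  shows "N_full n \<phi> \<chi> \<psi> s =
    of_nat (gamma_num s) / of_nat (K_num n s) * (\<Sum>k\<in>units_mod n. N_tuple n \<phi> \<chi> \<psi> (scale n k s))"
proof -
  let ?tp = "\<lambda>k. trans_perm_orbit n (affine n k 0 s)" and ?U = "units_mod n"
  have n0: "n > 0" using assms(4) by simp
  have fin: "finite ?U" by (auto simp: units_mod_def)
  \<comment> \<open>The representative picked by \<open>SOME\<close> is harmless because
    \<open>N_tuple\<close> is constant on the class.\<close>
  have cls: "N_class n \<phi> \<chi> \<psi> (?tp k) = N_tuple n \<phi> \<chi> \<psi> (scale n k s)" for k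
  proof -
    have in_t: "affine n k 0 s \<in> tuples n" by (rule affine_in[OF n0 assms(3)])
    hence "(SOME t. t \<in> ?tp k) \<in> ?tp k" by (intro someI) (rule mem_trans_perm_orbit_self[OF in_t n0])
    moreover have "length (affine n k 0 s) = n" using in_t by (simp add: tuples_def)
    ultimately show ?thesis unfolding N_class_def scale_eq_affine
      using N_tuple_trans_perm_orbit[OF assms(1,2) _ assms(5)] by blast
  qed
  have "(\<Sum>k\<in>?U. N_class n \<phi> \<chi> \<psi> (?tp k)) =
      (\<Sum>C\<in>?tp ` ?U. of_nat (card {k \<in> ?U. ?tp k = C}) * N_class n \<phi> \<chi> \<psi> C)"
    by (rule sum_fun_comp) (use fin in auto)
  also have "\<dots> = (\<Sum>C\<in>?tp ` ?U. of_nat (K_num n s) * N_class n \<phi> \<chi> \<psi> C)"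
    by (rule sum.cong[OF refl]) (use card_scale_fibre[OF assms(3,4)] in auto)
  finally have "(\<Sum>k\<in>?U. N_tuple n \<phi> \<chi> \<psi> (scale n k s)) =
      of_nat (K_num n s) * (\<Sum>C\<in>?tp ` ?U. N_class n \<phi> \<chi> \<psi> C)"
    by (simp only: cls sum_distrib_left)
  moreover have "(of_nat (K_num n s) :: 'w) \<noteq> 0" using K_num_pos[OF assms(3,4)] by simp
  ultimately show ?thesis
    unfolding N_full_def trans_perm_orbit_image_full_orbit[OF assms(3) n0] by simp
qed

section \<open>Divisibility of \<open>gamma_num\<close> by \<open>K_num\<close>\<close>

text \<open>A nonzero \<open>i\<close> generates the residues modulo a prime, so all multiplicities
  coincide; since they add up to \<open>n\<close>, each is 1.\<close>

lemma translation_invariant_distinct: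
  assumes "prime n" "t \<in> tuples n" "0 < i" "i < n" "mset (affine n 1 i t) = mset t"
  shows "distinct t"
proof -
  have n: "n > 0" using assms(4) by simp
  let ?f = "\<lambda>x. (x + i) mod n"
  have set_t: "set t \<subseteq> {..<n}" and len: "length t = n" using assms(2) by (auto simp: tuples_def)
  have inj: "inj_on ?f {..<n}" using bij_betw_add_mod[OF n] by (simp add: bij_betw_def)
  have step: "count (mset t) (?f b) = count (mset t) b" if "b < n" for b
  proof -
    have "?f -` {?f b} \<inter> set_mset (mset t) \<subseteq> {b}"
      using inj that set_t unfolding inj_on_def by auto
    moreover have "count (mset t) x = 0" if "x \<in> {b} - ?f -` {?f b} \<inter> set_mset (mset t)" for x
      using that by (auto simp: count_eq_zero_iff)
    ultimately have "(\<Sum>x\<in>?f -` {?f b} \<inter> set_mset (mset t). count (mset t) x) =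
        (\<Sum>x\<in>{b}. count (mset t) x)"
      by (intro sum.mono_neutral_left) auto
    hence "count (image_mset ?f (mset t)) (?f b) = count (mset t) b"
      by (simp only: count_image_mset sum.insert sum.empty) simp
    moreover have "image_mset ?f (mset t) = mset t" using assms(5) by (simp only: mset_affine mult_1)
    ultimately show ?thesis by simp
  qed
  have const: "count (mset t) ((l * i) mod n) = count (mset t) 0" for l
  proof (induction l)
    case (Suc l)
    have "(Suc l * i) mod n = ?f ((l * i) mod n)" by (simp add: mod_simps add.commute)
    thus ?case using step[of "(l * i) mod n"] Suc n by simp
  qed simp
  have "coprime i n"
    using assms(1,3,4) by (metis coprime_commute dvd_imp_le not_le prime_imp_coprime)
  then obtain u where u: "[i * u = 1] (mod n)" using cong_solve_coprime_nat[of i n] by auto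
  have all: "count (mset t) b = count (mset t) 0" if "b < n" for b
  proof -
    have "[b * (i * u) = b * 1] (mod n)" by (intro cong_mult u cong_refl)
    hence "(b * u * i) mod n = b" using that by (simp add: cong_def mult_ac)
    thus ?thesis using const[of "b * u"] by simp
  qed
  have "n = size (mset t)" using len by simp
  also have "\<dots> = (\<Sum>b\<in>set t. count (mset t) b)" by (simp add: size_multiset_overloaded_eq)
  also have "\<dots> = (\<Sum>b<n. count (mset t) b)"
    by (rule sum.mono_neutral_left) (use set_t in \<open>auto simp: count_eq_zero_iff\<close>)
  also have "\<dots> = (\<Sum>b<n. count (mset t) 0)" by (intro sum.cong refl all) simp
  also have "\<dots> = n * count (mset t) 0" by simp
  finally have one: "count (mset t) 0 = 1" using n by simp
  have "count (mset t) b = (if b \<in> set t then 1 else 0)" for b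
  proof (cases "b \<in> set t")
    case True
    hence "b < n" using set_t by auto
    thus ?thesis using all[of b] one True by simp
  qed (simp add: count_eq_zero_iff)
  thus ?thesis by (simp add: distinct_count_atmost_1)
qed

text \<open>The affine maps that preserve the multiset of entries of \<open>s\<close> act freely on the
  rearrangements of \<open>s\<close>, since \<open>s\<close> is not constant; none of them is a nontrivial translation,
  since \<open>s\<close> has a repeated entry, so there are \<open>K(s)\<close> of them.\<close>

lemma K_num_dvd_gamma_num:
  assumes "prime n" "s \<in> tuples n" "\<not> (\<exists>c. \<forall>i<n. s ! i = c)" "\<not> distinct s"
  shows "K_num n s dvd gamma_num s"
proof -
  have n1: "n > 1" using assms(1) by (rule prime_gt_1_nat)
  hence n0: "n > 0" by simp
  have len: "length s = n" and set_s: "set s \<subseteq> {..<n}" using assms(2) by (auto simp: tuples_def)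
  define R where "R = {t. mset t = mset s}"
  have "{permute_list \<sigma> s | \<sigma>. \<sigma> permutes {..<length s}} = R"
  proof (intro equalityI subsetI)
    fix t assume "t \<in> R"
    then obtain \<sigma> where "\<sigma> permutes {..<length s}" "permute_list \<sigma> s = t"
      unfolding R_def by (auto elim: mset_eq_permutation)
    thus "t \<in> {permute_list \<sigma> s | \<sigma>. \<sigma> permutes {..<length s}}" by auto
  qed (auto simp: R_def)
  hence gamma: "gamma_num s = card R" by (simp add: gamma_num_def)
  have finR: "finite R" unfolding R_def using mset_eq_finite by blast
  have R_tuples: "t \<in> tuples n" if "t \<in> R" for t
    using that assms(2) unfolding R_def tuples_def
    by (metis (mono_tags, lifting) mem_Collect_eq mset_eq_setD size_mset)
  \<comment> \<open>\<open>A\<close> represents the group of affine maps preserving the multiset of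
    entries of \<open>s\<close>.\<close>
  define A where "A = {(k, j). k \<in> units_mod n \<and> j < n \<and> mset (affine n k j s) = mset s}"
  have finA: "finite A"
    by (rule finite_subset[of _ "{..<n} \<times> {..<n}"]) (auto simp: A_def units_mod_def)
  have cardA: "card A = K_num n s"
  proof -
    have "inj_on fst A"
    proof (rule inj_onI)
      fix a b assume ab: "a \<in> A" "b \<in> A" "fst a = fst b"
      then obtain k i j where a: "a = (k, i)" and b: "b = (k, j)" by (metis prod.collapse)
      have False if "i < j" and ij: "(k, i) \<in> A" "(k, j) \<in> A" for i j
      proof -
        let ?t = "affine n k i s"
        have "affine n 1 (j - i) ?t = affine n k j s"
          unfolding affine_affine using that(1) by simp
        hence "mset (affine n 1 (j - i) ?t) = mset ?t" using ij by (simp add: A_def)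
        hence "distinct ?t"
          using that(1) ij by (intro translation_invariant_distinct[of n ?t "j - i"] assms(1) affine_in n0 assms(2))
            (auto simp: A_def)
        thus False using assms(4) by (auto simp: affine_def distinct_map)
      qed
      hence "i = j" using ab a b by (metis linorder_neqE_nat)
      thus "a = b" using a b by simp
    qed
    \<comment> \<open>A unit fixes the class of \<open>s\<close> exactly when some translation
      completes it to an element of \<open>A\<close>.\<close>
    moreover have "fst ` A = {k \<in> units_mod n. trans_perm_orbit n (affine n k 0 s) = trans_perm_orbit n s}"
    proof -
      have "(\<exists>j<n. mset (affine n k j s) = mset s) \<longleftrightarrow>
        trans_perm_orbit n (affine n k 0 s) = trans_perm_orbit n s" for k
      proof -
        let ?t = "affine n k 0 s"
        have t: "?t \<in> tuples n" "length ?t = n" using affine_in[OF n0 assms(2), of k 0] by (simp_all add: tuples_def)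
        have "trans_perm_orbit n ?t = trans_perm_orbit n s \<longleftrightarrow> s \<in> trans_perm_orbit n ?t"
          using trans_perm_orbit_eqI[OF t(1), of s] mem_trans_perm_orbit_self[OF assms(2) n0] by auto
        also have "\<dots> \<longleftrightarrow> (\<exists>j<n. mset s = mset (affine n 1 j ?t))"
          by (rule mem_trans_perm_orbit_iff[OF t(2)])
        also have "\<dots> \<longleftrightarrow> (\<exists>j<n. mset (affine n k j s) = mset s)"
          unfolding affine_affine by (auto dest: sym)
        finally show ?thesis by blast
      qed
      moreover have "fst ` A = {k \<in> units_mod n. \<exists>j<n. mset (affine n k j s) = mset s}"
        unfolding A_def image_def by auto
      ultimately show ?thesis by (simp only:)
    qed
    ultimately show ?thesis using K_num_eq[OF assms(2) n0] card_image[of fst A] by (simp only:)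
  qed
  define Orb where "Orb t = (\<lambda>(k, j). affine n k j t) ` A" for t
  have Orb_sub: "Orb t \<subseteq> R" if "t \<in> R" for t
    using that by (auto simp: Orb_def R_def A_def mset_affine)
  have card_Orb: "card (Orb t) = K_num n s" if t: "t \<in> R" for t
  proof -
    have "\<exists>x\<in>set t. \<exists>y\<in>set t. x \<noteq> y"
    proof (rule ccontr)
      assume "\<not> ?thesis"
      moreover have "set t = set s" using t by (auto simp: R_def dest: mset_eq_setD)
      ultimately have "s ! i = s ! 0" if "i < n" for i using that len n0 by (metis nth_mem)
      thus False using assms(3) by blast
    qed
    then obtain x y where xy: "x \<in> set t" "y \<in> set t" "x \<noteq> y" by auto
    have xyn: "x < n" "y < n" using xy R_tuples[OF t] by (auto simp: tuples_def)
    have "inj_on (\<lambda>(k, j). affine n k j t) A"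
    proof (rule inj_onI)
      fix a b assume ab: "a \<in> A" "b \<in> A" "(case a of (k, j) \<Rightarrow> affine n k j t) = (case b of (k, j) \<Rightarrow> affine n k j t)"
      obtain k j k' j' where [simp]: "a = (k, j)" "b = (k', j')" by (cases a, cases b)
      have lt: "k < n" "k' < n" "j < n" "j' < n" using ab by (auto simp: A_def units_mod_def)
      have eq: "(k * z + j) mod n = (k' * z + j') mod n" if "z \<in> set t" for z
        using ab(3) that by (auto simp: affine_def)
      have z: "int n dvd (int k - int k') * int z + (int j - int j')" if "z \<in> set t" for z
      proof -
        have "[int (k * z + j) = int (k' * z + j')] (mod int n)"
          unfolding cong_int_iff by (simp only: cong_def eq[OF that])
        thus ?thesis by (simp add: cong_iff_dvd_diff algebra_simps)
      qed
      \<comment> \<open>Agreement at two distinct entries \<open>x\<close> and \<open>y\<close>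
        gives, after subtraction, \<open>(k - k') * (x - y)\<close> divisible by the prime
        \<open>n\<close>.\<close>
      have "int n dvd ((int k - int k') * int x + (int j - int j')) - ((int k - int k') * int y + (int j - int j'))"
        by (intro dvd_diff z xy)
      hence "int n dvd (int k - int k') * (int x - int y)" by (simp add: algebra_simps)
      hence "int n dvd int k - int k' \<or> int n dvd int x - int y"
        using assms(1) by (simp add: prime_dvd_mult_iff)
      moreover have "\<not> int n dvd int x - int y"
        using xy(3) xyn by (auto simp: cong_iff_dvd_diff[symmetric] cong_int_iff cong_less_modulus_unique_nat)
      ultimately have "[k = k'] (mod n)" by (simp add: cong_iff_dvd_diff[symmetric] cong_int_iff)
      hence "k = k'" using lt by (simp add: cong_less_modulus_unique_nat)
      moreover from this have "[j = j'] (mod n)" using z[OF xy(1)]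
        by (simp add: cong_iff_dvd_diff[symmetric] cong_int_iff)
      hence "j = j'" using lt by (simp add: cong_less_modulus_unique_nat)
      ultimately show "a = b" by simp
    qed
    thus ?thesis using cardA by (simp add: Orb_def card_image)
  qed
  have self: "t \<in> Orb t" if "t \<in> R" for t
  proof -
    have "(1, 0) \<in> A" using n1 affine_1_0[OF assms(2)] by (simp add: A_def units_mod_def)
    thus ?thesis using affine_1_0[OF R_tuples[OF that]] by (force simp: Orb_def)
  qed
  \<comment> \<open>Since all orbits have the same size, inclusion suffices, and inverses of affine
    maps need not be formed.\<close>
  have trans: "Orb t' = Orb t" if t: "t \<in> R" "t' \<in> Orb t" for t t'
  proof (rule card_subset_eq)
    show "finite (Orb t)" using finA by (simp add: Orb_def)
    have t'R: "t' \<in> R" using Orb_sub t by blast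
    show "card (Orb t') = card (Orb t)" using card_Orb t'R t(1) by simp
    show "Orb t' \<subseteq> Orb t"
    proof
      fix x assume "x \<in> Orb t'"
      then obtain k' j' where x: "(k', j') \<in> A" "x = affine n k' j' t'" by (auto simp: Orb_def)
      obtain k j where t'eq: "(k, j) \<in> A" "t' = affine n k j t" using t(2) by (auto simp: Orb_def)
      have comp: "affine n k' j' (affine n k j r) = affine n ((k' * k) mod n) ((k' * j + j') mod n) r" for r
        unfolding affine_affine by (rule affine_cong) (auto simp: cong_def)
      have "mset (affine n k' j' (affine n k j s)) = mset s"
        using x(1) t'eq(1) by (simp add: A_def mset_affine)
      hence "((k' * k) mod n, (k' * j + j') mod n) \<in> A"
        using x(1) t'eq(1) n0 units_mod_mult[OF n1] unfolding comp by (simp add: A_def)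
      thus "x \<in> Orb t" using x(2) t'eq(2) comp by (force simp: Orb_def)
    qed
  qed
  have "K_num n s * card (Orb ` R) = card (\<Union> (Orb ` R))"
  proof (rule card_partition)
    show "finite (Orb ` R)" using finR by simp
    show "finite (\<Union> (Orb ` R))" using finR finA by (auto simp: Orb_def)
    show "card c = K_num n s" if "c \<in> Orb ` R" for c using that card_Orb by auto
    show "c1 \<inter> c2 = {}" if c: "c1 \<in> Orb ` R" "c2 \<in> Orb ` R" "c1 \<noteq> c2" for c1 c2
      using c trans by blast
  qed
  moreover have "\<Union> (Orb ` R) = R" using Orb_sub self by blast
  ultimately show ?thesis using gamma by (metis dvd_triv_left)
qed

lemma gamma_num_pos: "gamma_num s > 0"
proof -
  let ?S = "{permute_list \<sigma> s | \<sigma>. \<sigma> permutes {..<length s}}"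
  have "finite ?S"
    using finite_permutations[of "{..<length s}"] by simp
  moreover have "permute_list id s \<in> ?S" using permutes_id by blast
  ultimately have "card ?S \<noteq> 0" by auto
  thus ?thesis by (simp only: gamma_num_def)
qed

section \<open>Powers of the character and the final summation\<close>

lemma char_pow_char_pow: "char_pow (char_pow \<chi> j) k = char_pow \<chi> (j * k)"
  by (auto simp: char_pow_def power_mult)

lemma char_has_order_char_pow:
  assumes "char_has_order \<chi> n" "coprime j n"
  shows "char_has_order (char_pow \<chi> j) n"
proof -
  have "char_pow (char_pow \<chi> j) k = triv_char \<longleftrightarrow> n dvd k" for k
    unfolding char_pow_char_pow char_pow_eq_triv_iff[OF assms(1)]
    using assms(2) by (simp add: coprime_commute coprime_dvd_mult_right_iff)
  thus ?thesis using assms(1) by (auto simp: char_has_order_def dest: dvd_imp_le)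
qed

text \<open>Multiplication by the unit \<open>j\<close> permutes the residues, so the numerator of
  \<open>beta\<close> is unchanged, while the denominator and the trivial count agree entry by
  entry.\<close>

lemma N_tuple_char_pow:
  assumes "char_has_order \<chi> n" "j \<in> units_mod n" "length t = n"
  shows "N_tuple n \<phi> (char_pow \<chi> j) \<psi> t = N_tuple n \<phi> \<chi> \<psi> (scale n j t)"
proof -
  have n: "n > 0" using assms(1) by (simp add: char_has_order_def)
  have pow: "char_pow (char_pow \<chi> j) k = char_pow \<chi> ((j * k) mod n)" for k
    unfolding char_pow_char_pow by (rule char_pow_cong[OF assms(1)]) (simp add: cong_def)
  have "inj_on (\<lambda>k. (j * k) mod n) {..<n}"
  proof (rule inj_onI)
    fix a b assume "a \<in> {..<n}" "b \<in> {..<n}" "(j * a) mod n = (j * b) mod n"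
    moreover have "coprime j n" using assms(2) by (simp add: units_mod_def)
    ultimately have "[a = b] (mod n)" "a < n" "b < n"
      by (auto simp: cong_def[symmetric] cong_mult_lcancel_nat)
    thus "a = b" by (simp add: cong_less_modulus_unique_nat)
  qed
  moreover have "(\<lambda>k. (j * k) mod n) ` {..<n} \<subseteq> {..<n}" using n by auto
  ultimately have bij: "bij_betw (\<lambda>k. (j * k) mod n) {..<n} {..<n}"
    by (simp add: bij_betw_def endo_inj_surj)
  have num: "(\<Prod>i<n. gauss_sum \<phi> (char_mult (char_pow \<chi> ((j * i) mod n)) \<eta>)) =
      (\<Prod>i<n. gauss_sum \<phi> (char_mult (char_pow \<chi> i) \<eta>))" for \<eta>
    by (rule prod.reindex_bij_betw[OF bij])
  have nth: "scale n j t ! i = (j * t ! i) mod n" if "i < n" for i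
    using that assms(3) by (simp add: scale_def)
  have "triv_count (char_pow \<chi> j) t \<eta> = triv_count \<chi> (scale n j t) \<eta>" for \<eta>
    unfolding triv_count_def pow
    by (rule arg_cong[where f = card]) (use assms(3) nth in \<open>auto simp: scale_def\<close>)
  hence "beta n \<phi> (char_pow \<chi> j) t \<eta> = beta n \<phi> \<chi> (scale n j t) \<eta>" for \<eta>
    unfolding beta_def pow num using nth by simp
  thus ?thesis by (simp add: N_tuple_def)
qed

lemma units_mod_prime:
  assumes "prime n"
  shows "units_mod n = {1..<n}"
proof -
  have "coprime k n" if "0 < k" "k < n" for k
    using that assms by (metis coprime_commute dvd_imp_le not_le prime_imp_coprime)
  moreover have "\<not> coprime 0 n" using assms by auto
  ultimately show ?thesis
    unfolding units_mod_def by (auto intro!: Nat.gr0I simp: Suc_le_eq)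
qed

theorem theorem5p8:
  fixes \<phi> \<chi> :: "'a::{field,finite} \<Rightarrow> 'w::{alg_closed_field,field_char_0}"
    and \<psi> :: 'a
    and n q m m1 :: nat
    and s :: "nat list"
    and k v w :: "nat \<Rightarrow> nat"
  assumes "prime n" and "n \<ge> 5"
    and "q = CARD('a)" and "[q = 1] (mod n)"
    and "\<psi> \<noteq> 0"
    and "nontrivial_add_char \<phi>"
    and "\<chi> \<in> mult_chars" and "char_has_order \<chi> n"
    and "s \<in> tuples n" and "[sum_list s = 0] (mod n)"
    and "\<not> (\<exists>c. \<forall>i<n. s ! i = c)" and "\<not> distinct s"
    and "\<And>b. k b = card {i. i < n \<and> s ! i = b}"
    and "m = card {b. b < n \<and> k b = 0}"
    and "bij_betw v {1..m} {b. b < n \<and> k b = 0}"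
    and "\<And>i. i \<in> {1..m} \<Longrightarrow> w i < n \<and> k (w i) \<ge> 2"
    and "\<And>b. b < n \<Longrightarrow> k b \<ge> 2 \<Longrightarrow> card {i \<in> {1..m}. w i = b} = k b - 1"
    and "even m1" and "m1 + 2 \<le> m"
    and "\<And>i. 1 \<le> i \<Longrightarrow> i \<le> m1 div 2 \<Longrightarrow>
           [int (w (2 * i - 1)) - int (v (2 * i - 1)) = - (int (w (2 * i)) - int (v (2 * i)))] (mod int n)"
  shows "(\<exists>c::nat. c > 0 \<and> real (gamma_num s) / real (K_num n s) = real c) \<and>
    N_full n \<phi> \<chi> \<psi> s =
      of_nat (gamma_num s) / of_nat (K_num n s)
      * of_nat q powi (int ((n + 1) div 2) - int ((2 * m - m1) div 2))
      * of_int (int (card (H_points n m m1 v w \<psi>)) - (int q - 1) ^ (m - 1) * int q ^ (m - m1 - 2))"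
proof (rule conjI)
  have n1: "n > 1" using assms(2) by simp
  have len: "length s = n" using assms(9) by (simp add: tuples_def)
  have K0: "K_num n s > 0" by (rule K_num_pos[OF assms(9) n1])
  obtain c where c: "gamma_num s = K_num n s * c"
    using K_num_dvd_gamma_num[OF assms(1,9,11,12)] by (elim dvdE)
  moreover have "c > 0" using c gamma_num_pos[of s] by (intro Nat.gr0I) auto
  ultimately show "\<exists>c::nat. c > 0 \<and> real (gamma_num s) / real (K_num n s) = real c"
    using K0 by (intro exI[of _ c]) simp
  have k: "k = count (mset s)"
  proof
    fix b show "k b = count (mset s) b"
      using len unfolding assms(13) count_mset count_list_eq_length_filter length_filter_conv_card
      by (intro arg_cong[where f = card]) auto
  qed
  have k0: "{b. b < n \<and> k b = 0} = {b. b < n \<and> b \<notin> set s}"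
    by (simp add: k count_eq_zero_iff)
  interpret multiplicity_data n m m1 s v w
    by unfold_locales
      (use assms(1,2,9,10,15-20) in \<open>simp_all only: k0 k[symmetric]\<close>)
  let ?Q = "of_nat q powi (int ((n + 1) div 2) - int ((2 * m - m1) div 2)) :: 'w"
  let ?S = "\<lambda>j. \<Sum>x\<in>torus_points {1..2 * m - m1 - 2} {1..m} (\<psi> ^ n). char_pow \<chi> j (H_rhs n m m1 v w x)"
  have N: "N_tuple n \<phi> \<chi> \<psi> (scale n j s) = ?Q * ?S j" if "j \<in> units_mod n" for j
  proof -
    have "coprime j n" using that by (simp add: units_mod_def)
    \<comment> \<open>Only the character changes with \<open>j\<close>; \<open>s\<close>,
      \<open>v\<close> and \<open>w\<close> stay fixed, so every \<open>j\<close> leads to the same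
      \<open>H_rhs\<close>.\<close>
    then interpret character_data n m m1 s v w \<phi> "char_pow \<chi> j"
      by unfold_locales (intro assms char_pow_in char_has_order_char_pow)+
    show ?thesis
      using N_tuple_eq[OF assms(5)] N_tuple_char_pow[OF assms(8) that len, of \<phi> \<psi>] assms(3)
      by (simp add: point_sum_def q_def)
  qed
  \<comment> \<open>Because \<open>n\<close> is prime, the units are exactly the exponents
    \<open>1..<n\<close> summed over in the point count.\<close>
  have "(\<Sum>j\<in>units_mod n. N_tuple n \<phi> \<chi> \<psi> (scale n j s)) = ?Q * (\<Sum>j = 1..<n. ?S j)"
    unfolding units_mod_prime[OF assms(1), symmetric]
    by (subst sum_distrib_left) (intro sum.cong refl N)
  also have "(\<Sum>j = 1..<n. ?S j) =
      of_int (int (card (H_points n m m1 v w \<psi>)) - (int q - 1) ^ (m - 1) * int q ^ (m - m1 - 2))"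
    unfolding assms(3) by (rule card_H_points[OF assms(7,8,5,19), symmetric])
  finally show "N_full n \<phi> \<chi> \<psi> s =
      of_nat (gamma_num s) / of_nat (K_num n s)
      * of_nat q powi (int ((n + 1) div 2) - int ((2 * m - m1) div 2))
      * of_int (int (card (H_points n m m1 v w \<psi>)) - (int q - 1) ^ (m - 1) * int q ^ (m - m1 - 2))"
    unfolding N_full_eq[OF assms(7,8,9) n1 assms(5)] by (simp only: mult.assoc)
qed

end
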